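(* Let $X$ be a real Banach space with continuous dual $X^*$, and let $A, B\colon X\rightrightarrows X^*$ be maximally monotone operators with $\operatorname{dom} A\cap\operatorname{int}\operatorname{dom} B\neq\varnothing$. Assume that $A$ is of type (FPV) and that $\operatorname{dom}A$ is convex. Then $A+B$ is of type (FPV).
   Context: $X$ is a real Banach space, $X^*$ its continuous dual, $\langle\cdot,\cdot\rangle$ the duality pairing. A set-valued operator $A\colon X\rightrightarrows X^*$ assigns to each $x\in X$ a (possibly empty) subset $Ax\subseteq X^*$; its graph is $\operatorname{gra}A=\{(x,x^* )\in X\times X^*\mid x^*\in Ax\}$ and its domain is $\operatorname{dom}A=\{x\in X\mid Ax\neq\varnothing\}$. $A$ is monotone if $\langle x-y,x^*-y^*\rangle\ge 0$ for all $(x,x^* ),(y,y^* )\in\operatorname{gra}A$, and maximally monotone if it is monotone and has no proper monotone extension (in the sense of graph inclusion). The sum operator is $(A+B)x=\{a^*+b^*\mid a^*\in Ax,\ b^*\in Bx\}$. A pair $(x,x^* )\in X\times X^*$ is monotonically related to a set $G\subseteq X\times X^*$ if $\langle x-y,x^*-y^*\rangle\ge 0$ for all $(y,y^* )\in G$. An operator $A$ is of type (FPV) if it is maximally monotone and for every open convex set $U\subseteq X$ with $U\cap\operatorname{dom}A\neq\varnothing$: whenever $x\in U$ and $(x,x^* )$ is monotonically related to $\operatorname{gra}A\cap(U\times X^* )$, then $(x,x^* )\in\operatorname{gra}A$. $\operatorname{int}\operatorname{dom}B$ is the norm interior of $\operatorname{dom}B$. *)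

theory Defs
  imports "HOL-Analysis.Analysis"
begin

text \<open>
  The dual of \<open>X\<close> is the type of bounded linear functionals \<open>X \<Rightarrow>\<^sub>L \<real>\<close>. A set-valued operator from
  \<open>X\<close> to its dual is a total function into sets of functionals, the value \<open>{}\<close> being allowed.
\<close>

type_synonym 'a dual = "'a \<Rightarrow>\<^sub>L real"

type_synonym 'a set_op = "'a \<Rightarrow> 'a dual set"

definition gra :: "'a::real_normed_vector set_op \<Rightarrow> ('a \<times> 'a dual) set" where
  "gra A = {(x, xs). xs \<in> A x}"

definition dom_op :: "'a::real_normed_vector set_op \<Rightarrow> 'a set" where
  "dom_op A = {x. A x \<noteq> {}}"

definition sum_op :: "'a::real_normed_vector set_op \<Rightarrow> 'a set_op \<Rightarrow> 'a set_op" where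
  "sum_op A B = (\<lambda>x. {as + bs | as bs. as \<in> A x \<and> bs \<in> B x})"

definition monotone_op :: "'a::real_normed_vector set_op \<Rightarrow> bool" where
  "monotone_op A \<longleftrightarrow>
    (\<forall>(x, xs) \<in> gra A. \<forall>(y, ys) \<in> gra A. 0 \<le> blinfun_apply (xs - ys) (x - y))"

definition maximally_monotone :: "'a::real_normed_vector set_op \<Rightarrow> bool" where
  "maximally_monotone A \<longleftrightarrow> monotone_op A \<and> \<not> (\<exists>B. monotone_op B \<and> gra A \<subset> gra B)"

definition monotonically_related ::
    "'a::real_normed_vector \<times> 'a dual \<Rightarrow> ('a \<times> 'a dual) set \<Rightarrow> bool" where
  "monotonically_related = (\<lambda>(x, xs) G. \<forall>(y, ys) \<in> G. 0 \<le> blinfun_apply (xs - ys) (x - y))"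

definition type_FPV :: "'a::real_normed_vector set_op \<Rightarrow> bool" where
  "type_FPV A \<longleftrightarrow> maximally_monotone A \<and>
    (\<forall>U. open U \<and> convex U \<and> U \<inter> dom_op A \<noteq> {} \<longrightarrow>
      (\<forall>x xs. x \<in> U \<and> monotonically_related (x, xs) (gra A \<inter> (U \<times> UNIV)) \<longrightarrow>
        (x, xs) \<in> gra A))"

end

theory Submission
  imports Defs
begin

text \<open>
  Let \<open>(z, z\<^sup>*)\<close> be monotonically related to the graph of \<open>A + B\<close> over \<open>U\<close>, and let
  \<open>D = int dom B\<close>, which is convex and dense in \<open>dom B\<close>. A splitting \<open>z\<^sup>* = a\<^sup>* + b\<^sup>*\<close> with
  \<open>a\<^sup>* \<in> A z\<close>, \<open>b\<^sup>* \<in> B z\<close> amounts, by type (FPV) of \<open>A\<close> and maximality of \<open>B\<close>, to a functional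
  \<open>b\<^sup>*\<close> satisfying the affine bounds \<open>\<langle>y - z, b\<^sup>*\<rangle> \<le> \<langle>y - z, y\<^sup>*\<rangle>\<close> on the graph of \<open>B\<close> and
  \<open>\<langle>z - a, b\<^sup>*\<rangle> \<le> \<langle>a - z, a\<^sup>* - z\<^sup>*\<rangle>\<close> on the graph of \<open>A\<close> over \<open>U\<close>. The constraint qualification
  makes these bounds control \<open>b\<^sup>*\<close> on a ball, so by Hahn-Banach only the consistency of their conic
  combinations is at stake. Given combinations of both graphs with the same direction \<open>h\<close>, type (FPV)
  applied to \<open>(z + t h, 0)\<close> on small balls yields points of the graph of \<open>A\<close> near \<open>z + t h\<close>, where
  \<open>B\<close> is bounded; the hypothesis on \<open>(z, z\<^sup>*)\<close> at these points gives consistency as \<open>t \<rightarrow> 0\<close>.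

  This requires \<open>z\<close> to lie in the closures of \<open>dom A\<close> and \<open>D\<close>. Otherwise type (FPV), applied
  near the segment from a point \<open>x\<^sub>0 \<in> dom A \<inter> D\<close> towards \<open>z\<close> with larger and larger functionals,
  produces \<open>(a, a\<^sup>*)\<close> in the graph of \<open>A\<close> with \<open>\<langle>z - a, a\<^sup>*\<rangle>\<close> arbitrarily large, while
  \<open>\<langle>z - a, b\<^sup>*\<rangle>\<close> stays bounded below for \<open>b\<^sup>* \<in> B a\<close>.
\<close>

section \<open>Hahn-Banach for cones of affine bounds\<close>

definition sublinear :: "('a::real_vector \<Rightarrow> real) \<Rightarrow> bool" where
  "sublinear p \<longleftrightarrow> (\<forall>x y. p (x + y) \<le> p x + p y) \<and> (\<forall>c>0. \<forall>x. p (c *\<^sub>R x) \<le> c * p x)"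

lemma sublinear_add: "sublinear p \<Longrightarrow> p (x + y) \<le> p x + p y"
  by (simp add: sublinear_def)

lemma sublinear_scale_le: "sublinear p \<Longrightarrow> 0 < c \<Longrightarrow> p (c *\<^sub>R x) \<le> c * p x"
  by (simp add: sublinear_def)

lemma sublinear_scale:
  assumes "sublinear p" "0 < c"
  shows "p (c *\<^sub>R x) = c * p x"
proof (rule antisym)
  have "p (inverse c *\<^sub>R (c *\<^sub>R x)) \<le> inverse c * p (c *\<^sub>R x)"
    using assms by (intro sublinear_scale_le) auto
  then show "c * p x \<le> p (c *\<^sub>R x)"
    using assms(2) by (simp add: field_simps)
qed (use assms in \<open>rule sublinear_scale_le\<close>)

lemma sublinear_zero:
  assumes "sublinear p" shows "p 0 = 0"
  using sublinear_scale[OF assms, of 2 0] by simp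

lemma sublinear_minus:
  assumes "sublinear p" shows "- p (- x) \<le> p x"
  using sublinear_add[OF assms, of x "- x"] sublinear_zero[OF assms] by simp

text \<open>This supplies the bounds that Zorn's lemma asks for. Of two members of a chain the
  smaller lies below both, so its subadditivity bounds the infimum at \<open>x + y\<close> by
  \<open>q x + r y\<close> for independent \<open>q\<close> and \<open>r\<close>.\<close>

lemma sublinear_chain_Inf:
  assumes ne: "C \<noteq> {}" and sub: "\<And>q. q \<in> C \<Longrightarrow> sublinear q"
    and total: "\<And>q r. q \<in> C \<Longrightarrow> r \<in> C \<Longrightarrow> q \<le> r \<or> r \<le> q"
    and below: "\<And>x. bdd_below ((\<lambda>q. q x) ` C)"
  shows "sublinear (\<lambda>x. INF q\<in>C. q x)"
  unfolding sublinear_def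
proof (intro conjI allI impI)
  fix x y
  have *: "(INF q\<in>C. q (x + y)) \<le> q x + r y" if "q \<in> C" "r \<in> C" for q r
  proof -
    from total[OF that] \<open>q \<in> C\<close> \<open>r \<in> C\<close> obtain s where s: "s \<in> C" "s \<le> q" "s \<le> r"
      by blast
    have "(INF q\<in>C. q (x + y)) \<le> s (x + y)"
      by (rule cINF_lower[OF below s(1)])
    also have "\<dots> \<le> s x + s y" by (rule sublinear_add[OF sub[OF s(1)]])
    also have "\<dots> \<le> q x + r y" using s(2,3) by (simp add: add_mono le_fun_def)
    finally show ?thesis .
  qed
  have "(INF q\<in>C. q (x + y)) - r y \<le> (INF q\<in>C. q x)" if "r \<in> C" for r
    using *[OF _ that] by (intro cINF_greatest[OF ne]) (simp add: algebra_simps)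
  then have "(INF q\<in>C. q (x + y)) - (INF q\<in>C. q x) \<le> (INF r\<in>C. r y)"
    by (intro cINF_greatest[OF ne]) (simp add: algebra_simps)
  then show "(INF q\<in>C. q (x + y)) \<le> (INF q\<in>C. q x) + (INF q\<in>C. q y)" by simp
next
  fix c :: real and x assume c: "0 < c"
  have "(INF q\<in>C. q (c *\<^sub>R x)) / c \<le> (INF q\<in>C. q x)"
  proof (rule cINF_greatest[OF ne])
    fix q assume q: "q \<in> C"
    have "(INF q\<in>C. q (c *\<^sub>R x)) \<le> q (c *\<^sub>R x)" by (rule cINF_lower[OF below q])
    also have "\<dots> = c * q x" by (rule sublinear_scale[OF sub[OF q] c])
    finally show "(INF q\<in>C. q (c *\<^sub>R x)) / c \<le> q x" using c by (simp add: field_simps)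
  qed
  then show "(INF q\<in>C. q (c *\<^sub>R x)) \<le> c * (INF q\<in>C. q x)"
    using c by (simp add: field_simps)
qed

text \<open>At \<open>t = 0\<close> the second claim gives \<open>r \<le> q\<close>; at
  \<open>t = 1\<close> it gives \<open>r y + q v \<le> q (y + v)\<close>, which for a minimal
  \<open>q\<close> is the missing half of additivity.\<close>

lemma sublinear_shift_Inf:
  fixes v :: "'a::real_vector"
  assumes q: "sublinear q"
  defines "r \<equiv> \<lambda>y. INF t\<in>{0..}. q (y + t *\<^sub>R v) - t * q v"
  shows "sublinear r" and "t \<ge> 0 \<Longrightarrow> r y \<le> q (y + t *\<^sub>R v) - t * q v"
proof -
  have lb: "- q (- y) \<le> q (y + t *\<^sub>R v) - t * q v" if "t \<ge> 0" for t y
  proof -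
    have "q (t *\<^sub>R v) = t * q v"
      using that sublinear_scale[OF q] sublinear_zero[OF q] by (cases "t = 0") auto
    moreover have "q (t *\<^sub>R v) \<le> q (y + t *\<^sub>R v) + q (- y)"
      using sublinear_add[OF q, of "y + t *\<^sub>R v" "- y"] by simp
    ultimately show ?thesis by simp
  qed
  have bdd: "bdd_below ((\<lambda>t. q (y + t *\<^sub>R v) - t * q v) ` {0..})" for y
    by (rule bdd_belowI2[of _ "- q (- y)"]) (use lb in auto)
  have r_eq: "r y = (INF t\<in>{0..}. q (y + t *\<^sub>R v) - t * q v)" for y
    by (simp add: r_def)
  show r_le: "r y \<le> q (y + t *\<^sub>R v) - t * q v" if "t \<ge> 0" for t y
    unfolding r_eq by (rule cINF_lower[OF bdd]) (use that in simp)
  show "sublinear r"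
    unfolding sublinear_def
  proof (intro conjI allI impI)
    fix x y
    have *: "r (x + y) \<le> (q (x + s *\<^sub>R v) - s * q v) + (q (y + t *\<^sub>R v) - t * q v)"
      if "s \<ge> 0" "t \<ge> 0" for s t
    proof -
      have "r (x + y) \<le> q ((x + y) + (s + t) *\<^sub>R v) - (s + t) * q v"
        by (rule r_le) (use that in simp)
      moreover have "q ((x + y) + (s + t) *\<^sub>R v) \<le> q (x + s *\<^sub>R v) + q (y + t *\<^sub>R v)"
        using sublinear_add[OF q, of "x + s *\<^sub>R v" "y + t *\<^sub>R v"] by (simp add: algebra_simps)
      ultimately show ?thesis by (simp add: algebra_simps)
    qed
    have "r (x + y) - (q (y + t *\<^sub>R v) - t * q v) \<le> r x" if "t \<ge> 0" for t
      unfolding r_eq[of x] using *[OF _ that] by (intro cINF_greatest) (auto simp: algebra_simps)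
    then have "r (x + y) - r x \<le> r y"
      unfolding r_eq[of y] by (intro cINF_greatest) (auto simp: algebra_simps)
    then show "r (x + y) \<le> r x + r y" by simp
  next
    fix c :: real and x assume c: "0 < c"
    have "r (c *\<^sub>R x) / c \<le> r x"
      unfolding r_eq[of x]
    proof (rule cINF_greatest)
      fix t :: real assume t: "t \<in> {0..}"
      have "r (c *\<^sub>R x) \<le> q (c *\<^sub>R x + (c * t) *\<^sub>R v) - (c * t) * q v"
        by (rule r_le) (use t c in simp)
      also have "q (c *\<^sub>R x + (c * t) *\<^sub>R v) = c * q (x + t *\<^sub>R v)"
        using sublinear_scale[OF q c, of "x + t *\<^sub>R v"] by (simp add: algebra_simps)
      finally show "r (c *\<^sub>R x) / c \<le> q (x + t *\<^sub>R v) - t * q v"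
        using c by (simp add: field_simps)
    qed simp
    then show "r (c *\<^sub>R x) \<le> c * r x" using c by (simp add: field_simps)
  qed
qed

text \<open>Minimality forces \<open>q\<close> to agree with its smaller companions from the previous lemma, which
  turns subadditivity into additivity.\<close>

lemma linear_minimal_sublinear:
  assumes q: "sublinear q" and min: "\<And>r. sublinear r \<Longrightarrow> r \<le> q \<Longrightarrow> r = q"
  shows "linear q"
proof -
  have add: "q (x + v) = q x + q v" for x v
  proof -
    define r where "r = (\<lambda>y. INF t\<in>{0..}. q (y + t *\<^sub>R v) - t * q v)"
    have "sublinear r" unfolding r_def by (rule sublinear_shift_Inf(1)[OF q])
    have le: "r y \<le> q (y + t *\<^sub>R v) - t * q v" if "t \<ge> 0" for y t
      unfolding r_def by (rule sublinear_shift_Inf(2)[OF q that])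
    have "r \<le> q" using le[of 0] by (simp add: le_fun_def)
    then have "r = q" by (rule min[OF \<open>sublinear r\<close>])
    then show ?thesis
      using le[of 1 x] sublinear_add[OF q, of x v] by simp
  qed
  have neg: "q (- x) = - q x" for x
    using add[of x "- x"] sublinear_zero[OF q] by simp
  show ?thesis
  proof (rule linearI)
    fix c :: real and x
    show "q (c *\<^sub>R x) = c *\<^sub>R q x"
    proof (cases c "0::real" rule: linorder_cases)
      case less
      then have "q ((- c) *\<^sub>R x) = (- c) * q x" by (intro sublinear_scale[OF q]) simp
      then show ?thesis using neg[of "c *\<^sub>R x"] by simp
    qed (use sublinear_zero[OF q] sublinear_scale[OF q] in auto)
  qed (rule add)
qed

theorem Hahn_Banach_sublinear:
  assumes p: "sublinear p"
  obtains f where "linear f" "\<And>x. f x \<le> p x"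
proof -
  define A where "A = {q. sublinear q \<and> q \<le> p}"
  \<comment> \<open>Zorn's lemma is used with the reversed order, so its maximal element is a
    minimal sublinear functional below \<open>p\<close>.\<close>
  have "\<exists>m\<in>A. \<forall>a\<in>A. a \<le> m \<longrightarrow> a = m"
  proof (rule predicate_Zorn[of A "\<lambda>x y. y \<le> x"])
    show "partial_order_on A (relation_of (\<lambda>x y. y \<le> x) A)"
      by (rule partial_order_on_relation_ofI) auto
  next
    fix C assume C: "C \<in> Chains (relation_of (\<lambda>x y. y \<le> x) A)"
    then have CA: "C \<subseteq> A" and tot: "\<And>q r. q \<in> C \<Longrightarrow> r \<in> C \<Longrightarrow> q \<le> r \<or> r \<le> q"
      by (auto simp: Chains_def relation_of_def)
    show "\<exists>u\<in>A. \<forall>a\<in>C. u \<le> a"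
    proof (cases "C = {}")
      case True
      then show ?thesis using p by (auto simp: A_def)
    next
      case False
      have bdd: "bdd_below ((\<lambda>q. q x) ` C)" for x
      proof (rule bdd_belowI2)
        fix q assume "q \<in> C"
        then have "sublinear q" "q (- x) \<le> p (- x)" using CA by (auto simp: A_def le_fun_def)
        then show "- p (- x) \<le> q x" using sublinear_minus[of q x] by simp
      qed
      define u where "u = (\<lambda>x. INF q\<in>C. q x)"
      have "sublinear u"
        unfolding u_def using False bdd tot CA by (intro sublinear_chain_Inf) (auto simp: A_def)
      moreover have ua: "u \<le> a" if "a \<in> C" for a
        unfolding u_def le_fun_def using cINF_lower[OF bdd that] by blast
      moreover have "u \<le> p"
      proof -
        obtain a where "a \<in> C" using False by blast
        then have "u \<le> a" "a \<le> p" using ua CA by (auto simp: A_def)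
        then show ?thesis by (rule order_trans)
      qed
      ultimately show ?thesis by (auto simp: A_def)
    qed
  qed
  then obtain m where m: "sublinear m" "m \<le> p" and min: "\<And>a. sublinear a \<Longrightarrow> a \<le> p \<Longrightarrow> a \<le> m \<Longrightarrow> a = m"
    by (auto simp: A_def)
  have "linear m"
  proof (rule linear_minimal_sublinear[OF m(1)])
    fix r assume "sublinear r" "r \<le> m"
    then show "r = m" using min order_trans[OF _ m(2)] by simp
  qed
  then show ?thesis using that m(2) by (auto simp: le_fun_def)
qed

text \<open>Applying the bound to \<open>- u\<close> makes it two-sided. The constant
  \<open>2 * M / r\<close> comes from rescaling \<open>x\<close> to norm \<open>r / 2\<close>,
  inside the open ball.\<close>

lemma bounded_linear_of_bounded_above_on_ball:
  fixes f :: "'a::real_normed_vector \<Rightarrow> real"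
  assumes f: "linear f" and r: "0 < r" and le: "\<And>u. norm u < r \<Longrightarrow> f u \<le> M"
  shows "bounded_linear f"
proof -
  interpret linear f by (rule f)
  have abs: "\<bar>f u\<bar> \<le> M" if "norm u < r" for u
    using le[of u] le[of "- u"] that by (simp add: neg abs_le_iff)
  have "norm (f x) \<le> norm x * (2 * M / r)" for x
  proof (cases "x = 0")
    case False
    have "\<bar>f ((r / (2 * norm x)) *\<^sub>R x)\<bar> \<le> M" by (rule abs) (use False r in simp)
    then show ?thesis using False r by (simp add: scale abs_mult field_simps)
  qed (simp add: zero)
  then show ?thesis by (intro bounded_linear_intro[where K = "2 * M / r"]) (auto simp: add scale)
qed

text \<open>A pair \<open>(h, c) \<in> K\<close> stands for the bound \<open>f h \<le> c\<close> imposed on the functional sought.\<close>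

theorem Hahn_Banach_cone:
  fixes K :: "('a::real_normed_vector \<times> real) set"
  assumes K: "convex_cone K" and zero: "\<And>c. (0, c) \<in> K \<Longrightarrow> 0 \<le> c"
    and r: "0 < r" and ball: "\<And>u. norm u < r \<Longrightarrow> \<exists>c\<le>M. (u, c) \<in> K"
  obtains f :: "'a dual" where "\<And>h c. (h, c) \<in> K \<Longrightarrow> blinfun_apply f h \<le> c"
proof -
  have addK: "(h + h', c + c') \<in> K" if "(h, c) \<in> K" "(h', c') \<in> K" for h h' c c'
    using convex_cone_add[OF K that] by simp
  have scaleK: "(s *\<^sub>R h, s * c) \<in> K" if "(h, c) \<in> K" "0 \<le> s" for h c s
    using convex_cone_scaleR[OF K that(2,1)] by simp
  have ex: "\<exists>c. (h, c) \<in> K" for h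
  proof (cases "h = 0")
    case True
    then show ?thesis using ball[of 0] r by auto
  next
    case False
    obtain c where "((r / (2 * norm h)) *\<^sub>R h, c) \<in> K"
      using ball[of "(r / (2 * norm h)) *\<^sub>R h"] r False by auto
    from scaleK[OF this, of "2 * norm h / r"] show ?thesis using r False by auto
  qed
  define S where "S h = {c. (h, c) \<in> K}" for h
  have ne: "S h \<noteq> {}" for h using ex by (auto simp: S_def)
  \<comment> \<open>Adding a bound in direction \<open>- h\<close> gives an element over
    \<open>0\<close>, where bounds are nonnegative; so the tightest bound in direction
    \<open>h\<close> is finite.\<close>
  have bdd: "bdd_below (S h)" for h
  proof -
    obtain c' where c': "(- h, c') \<in> K" using ex by blast
    show ?thesis
    proof (rule bdd_belowI[of _ "- c'"])
      fix c assume "c \<in> S h"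
      then have "(0, c + c') \<in> K" using addK[OF _ c', of h c] by (simp add: S_def)
      then show "- c' \<le> c" using zero by fastforce
    qed
  qed
  define p where "p h = Inf (S h)" for h
  have p_le: "p h \<le> c" if "(h, c) \<in> K" for h c
    unfolding p_def by (rule cInf_lower) (use that bdd in \<open>auto simp: S_def\<close>)
  have "sublinear p"
    unfolding sublinear_def
  proof (intro conjI allI impI)
    fix x y
    have "p (x + y) - d \<le> p x" if "d \<in> S y" for d
      unfolding p_def[of x]
      by (rule cInf_greatest[OF ne]) (use that p_le[OF addK] in \<open>force simp: S_def diff_le_eq\<close>)
    then have "p (x + y) - p x \<le> p y"
      unfolding p_def[of y] by (intro cInf_greatest[OF ne]) (auto simp: algebra_simps)
    then show "p (x + y) \<le> p x + p y" by simp
  next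
    fix s :: real and x assume s: "0 < s"
    have "p (s *\<^sub>R x) / s \<le> p x"
      unfolding p_def[of x]
    proof (rule cInf_greatest[OF ne])
      fix c assume "c \<in> S x"
      then have "p (s *\<^sub>R x) \<le> s * c" using s by (intro p_le scaleK) (auto simp: S_def)
      then show "p (s *\<^sub>R x) / s \<le> c" using s by (simp add: field_simps)
    qed
    then show "p (s *\<^sub>R x) \<le> s * p x" using s by (simp add: field_simps)
  qed
  then obtain f where f: "linear f" "\<And>x. f x \<le> p x"
    using Hahn_Banach_sublinear by blast
  have "bounded_linear f"
  proof (rule bounded_linear_of_bounded_above_on_ball[OF f(1) r])
    fix u :: 'a assume "norm u < r"
    then obtain c where "c \<le> M" "(u, c) \<in> K" using ball by blast
    then show "f u \<le> M" using f(2)[of u] p_le[of u c] by linarith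
  qed
  then have "blinfun_apply (Blinfun f) h \<le> c" if "(h, c) \<in> K" for h c
    using f(2)[of h] p_le[OF that] by (simp add: bounded_linear_Blinfun_apply)
  then show ?thesis by (rule that)
qed

section \<open>Functionals and convex sets\<close>

lemma norm_blinfun_le_of_cball:
  fixes f :: "'a::real_normed_vector dual"
  assumes r: "0 < r" and le: "\<And>u. norm u \<le> r \<Longrightarrow> f u \<le> M"
  shows "r * norm f \<le> M"
proof -
  have "0 \<le> M" using le[of 0] r by simp
  have "norm f \<le> M / r"
  proof (rule norm_blinfun_bound)
    fix x
    show "norm (f x) \<le> M / r * norm x"
    proof (cases "x = 0")
      case False
      let ?u = "(r / norm x) *\<^sub>R x"
      have "f ?u \<le> M" "f (- ?u) \<le> M" by (rule le; use r False in simp)+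
      then have "r / norm x * \<bar>f x\<bar> \<le> M"
        by (cases "0 \<le> f x") (auto simp: blinfun.bilinear_simps)
      then show ?thesis using r False by (simp add: field_simps)
    qed simp
  qed (use \<open>0 \<le> M\<close> r in simp)
  then show ?thesis using r by (simp add: field_simps)
qed

lemma blinfun_apply_le: "blinfun_apply (f::'a::real_normed_vector dual) x \<le> norm f * norm x"
  and minus_blinfun_apply_le: "- blinfun_apply f x \<le> norm f * norm x"
  using norm_blinfun[of f x] by auto

text \<open>The cone encodes the bounds \<open>f x \<le> norm x\<close> and
  \<open>f (- d) \<le> - norm d\<close>. They are consistent, since \<open>x = s *\<^sub>R d\<close>
  forces \<open>norm x = s * norm d\<close>.\<close>

lemma exists_norming_functional:
  fixes d :: "'a::real_normed_vector"
  obtains f :: "'a dual" where "f d = norm d" "norm f \<le> 1"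
proof -
  define K where "K = {(x - s *\<^sub>R d, c) | x s c. 0 \<le> s \<and> norm x - s * norm d \<le> c}"
  have KI: "(x - s *\<^sub>R d, c) \<in> K" if "0 \<le> s" "norm x - s * norm d \<le> c" for x s c
    using that by (auto simp: K_def)
  have K: "convex_cone K"
    unfolding convex_cone_iff
  proof (intro conjI ballI allI impI)
    show "0 \<in> K" using KI[of 0 0 0] by (simp add: zero_prod_def)
  next
    fix v w assume "v \<in> K" "w \<in> K"
    then obtain x s c y t e where
      v: "v = (x - s *\<^sub>R d, c)" "0 \<le> s" "norm x - s * norm d \<le> c" and
      w: "w = (y - t *\<^sub>R d, e)" "0 \<le> t" "norm y - t * norm d \<le> e"
      by (auto simp: K_def)
    have "norm (x + y) - (s + t) * norm d \<le> c + e"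
      using v(3) w(3) norm_triangle_ineq[of x y] by (simp add: algebra_simps)
    then have "((x + y) - (s + t) *\<^sub>R d, c + e) \<in> K" using v w by (intro KI) auto
    then show "v + w \<in> K" by (simp add: v w algebra_simps)
  next
    fix v and r :: real assume "v \<in> K" "0 \<le> r"
    then obtain x s c where v: "v = (x - s *\<^sub>R d, c)" "0 \<le> s" "norm x - s * norm d \<le> c"
      by (auto simp: K_def)
    have "r * (norm x - s * norm d) \<le> r * c" using v(3) \<open>0 \<le> r\<close> by (rule mult_left_mono)
    then have "((r *\<^sub>R x) - (r * s) *\<^sub>R d, r * c) \<in> K"
      using v \<open>0 \<le> r\<close> by (intro KI) (auto simp: algebra_simps)
    then show "r *\<^sub>R v \<in> K" by (simp add: v algebra_simps)
  qed
  obtain f where f: "\<And>h c. (h, c) \<in> K \<Longrightarrow> blinfun_apply f h \<le> c"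
  proof (rule Hahn_Banach_cone[OF K, of 1 1])
    fix c assume "(0, c) \<in> K"
    then show "0 \<le> c" by (auto simp: K_def)
  next
    fix u :: 'a assume "norm u < 1"
    then show "\<exists>c\<le>1. (u, c) \<in> K" using KI[of 0 u 1] by auto
  qed auto
  have "f x \<le> norm x" for x using f[of x "norm x"] KI[of 0 x] by simp
  moreover have "f (- d) \<le> - norm d" using f KI[of 1 0 "- norm d"] by simp
  ultimately have "f d = norm d" by (simp add: blinfun.bilinear_simps antisym)
  moreover have "1 * norm f \<le> 1"
    using \<open>\<And>x. f x \<le> norm x\<close> order_trans by (intro norm_blinfun_le_of_cball) auto
  ultimately show ?thesis using that by simp
qed

text \<open>The cone encodes \<open>f (x - a) \<le> 0\<close> on \<open>C\<close> together with
  \<open>f (a - x0) = 1\<close>, as \<open>c\<close> runs over both signs. An element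
  \<open>(0, c)\<close> with \<open>c < 0\<close> would exhibit \<open>a\<close> as a convex
  combination of a point of \<open>C\<close> and \<open>x0\<close>.\<close>

lemma exists_supporting_functional:
  fixes C :: "'a::real_normed_vector set"
  assumes C: "open C" "convex C" and x0: "x0 \<in> C" and a: "a \<notin> C"
  shows "\<exists>f::'a dual. (\<forall>x\<in>C. f (x - a) \<le> 0) \<and> f (x0 - a) < 0"
proof -
  define K where "K = {(s *\<^sub>R (x - a) + c *\<^sub>R (a - x0), c) | s x c. 0 \<le> s \<and> x \<in> C}"
  have KI: "(s *\<^sub>R (x - a) + c *\<^sub>R (a - x0), c) \<in> K" if "0 \<le> s" "x \<in> C" for s x c
    using that by (auto simp: K_def)
  have K: "convex_cone K"
    unfolding convex_cone_iff
  proof (intro conjI ballI allI impI)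
    show "0 \<in> K" using KI[of 0 x0 0] x0 by (simp add: zero_prod_def)
  next
    fix v w assume "v \<in> K" "w \<in> K"
    then obtain s x c t y e where
      v: "v = (s *\<^sub>R (x - a) + c *\<^sub>R (a - x0), c)" "0 \<le> s" "x \<in> C" and
      w: "w = (t *\<^sub>R (y - a) + e *\<^sub>R (a - x0), e)" "0 \<le> t" "y \<in> C"
      by (auto simp: K_def)
    show "v + w \<in> K"
    proof (cases "s + t = 0")
      case True
      then have "s = 0" "t = 0" using v w by auto
      then show ?thesis using KI[of 0 x0 "c + e"] x0 by (simp add: v w algebra_simps)
    next
      case False
      then have pos: "0 < s + t" using v w by auto
      let ?z = "(s / (s + t)) *\<^sub>R x + (t / (s + t)) *\<^sub>R y"
      have "?z \<in> C"
        using v w pos by (intro convexD[OF C(2)]) (auto simp flip: add_divide_distrib)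
      moreover have "(s + t) *\<^sub>R ?z = s *\<^sub>R x + t *\<^sub>R y"
        using pos by (simp add: scaleR_add_right)
      then have "(s + t) *\<^sub>R (?z - a) = s *\<^sub>R (x - a) + t *\<^sub>R (y - a)"
        by (simp add: algebra_simps)
      ultimately show ?thesis
        using KI[of "s + t" ?z "c + e"] pos by (simp add: v w algebra_simps)
    qed
  next
    fix v and r :: real assume "v \<in> K" "0 \<le> r"
    then obtain s x c where v: "v = (s *\<^sub>R (x - a) + c *\<^sub>R (a - x0), c)" "0 \<le> s" "x \<in> C"
      by (auto simp: K_def)
    show "r *\<^sub>R v \<in> K"
      using KI[of "r * s" x "r * c"] v \<open>0 \<le> r\<close> by (simp add: scaleR_add_right)
  qed
  obtain e where e: "0 < e" "ball x0 e \<subseteq> C" using C(1) x0 openE by blast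
  obtain f where f: "\<And>h c. (h, c) \<in> K \<Longrightarrow> blinfun_apply f h \<le> c"
  proof (rule Hahn_Banach_cone[OF K, of e 1])
    fix c assume "(0, c) \<in> K"
    then obtain s x where s: "s *\<^sub>R (x - a) + c *\<^sub>R (a - x0) = 0" "0 \<le> s" "x \<in> C"
      by (auto simp: K_def)
    show "0 \<le> c"
    proof (rule ccontr)
      assume "\<not> 0 \<le> c"
      then have c: "c < 0" by simp
      then have pos: "0 < s - c" using s by simp
      have "(s - c) *\<^sub>R a = s *\<^sub>R x + (- c) *\<^sub>R x0"
        using s(1) by (simp add: algebra_simps)
      then have "(1 / (s - c)) *\<^sub>R ((s - c) *\<^sub>R a) = (1 / (s - c)) *\<^sub>R (s *\<^sub>R x + (- c) *\<^sub>R x0)"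
        by simp
      then have "a = (s / (s - c)) *\<^sub>R x + (- c / (s - c)) *\<^sub>R x0"
        using pos by (simp add: scaleR_diff_right)
      moreover have "(s / (s - c)) *\<^sub>R x + (- c / (s - c)) *\<^sub>R x0 \<in> C"
      proof (rule convexD[OF C(2) s(3) x0])
        show "s / (s - c) + - c / (s - c) = 1"
          using pos by (simp flip: diff_divide_distrib)
      qed (use s c pos in \<open>auto simp: divide_nonpos_pos\<close>)
      ultimately show False using a by simp
    qed
  next
    fix u :: 'a assume "norm u < e"
    then have "x0 + u \<in> C" using e by (auto simp: dist_norm)
    then show "\<exists>c\<le>1. (u, c) \<in> K" using KI[of 1 "x0 + u" 1] by auto
  qed (use e in auto)
  have "f (x - a) \<le> 0" if "x \<in> C" for x
    using f[of "x - a" 0] KI[of 1 x 0] that by simp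
  moreover have "f (x0 - a) \<le> - 1"
    using f[of "x0 - a" "- 1"] KI[of 0 x0 "- 1"] x0 by simp
  ultimately show ?thesis by (intro exI[of _ f]) auto
qed

text \<open>Replace \<open>y\<close> by a point \<open>y'\<close> of \<open>C\<close> closer than
  \<open>t * e\<close>; the correction, divided by \<open>t\<close>, moves \<open>x\<close> by less
  than \<open>e\<close> and so within the ball about \<open>x\<close>.\<close>

lemma open_convex_closure_shrink:
  fixes C :: "'a::real_normed_vector set"
  assumes C: "open C" "convex C" and x: "x \<in> C" and y: "y \<in> closure C" and t: "0 < t" "t \<le> 1"
  shows "(1 - t) *\<^sub>R y + t *\<^sub>R x \<in> C"
proof -
  obtain e where e: "0 < e" "ball x e \<subseteq> C" using C(1) x openE by blast
  obtain y' where y': "y' \<in> C" "dist y' y < t * e"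
    using y e t by (meson closure_approachable mult_pos_pos)
  define x' where "x' = x + ((1 - t) / t) *\<^sub>R (y - y')"
  have "norm (x' - x) = (1 - t) / t * norm (y - y')" using t by (simp add: x'_def)
  also have "\<dots> \<le> 1 / t * norm (y - y')" using t by (intro mult_right_mono divide_right_mono) auto
  also have "\<dots> < e" using y'(2) t by (simp add: dist_norm norm_minus_commute field_simps)
  finally have "x' \<in> C" using e by (auto simp: dist_norm norm_minus_commute)
  then have "(1 - t) *\<^sub>R y' + t *\<^sub>R x' \<in> C" using y' t by (intro convexD[OF C(2)]) auto
  also have "(1 - t) *\<^sub>R y' + t *\<^sub>R x' = (1 - t) *\<^sub>R y + t *\<^sub>R x"
  proof -
    have "t *\<^sub>R x' = t *\<^sub>R x + (1 - t) *\<^sub>R (y - y')"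
      using t by (simp add: x'_def scaleR_add_right)
    then show ?thesis by (simp add: algebra_simps)
  qed
  finally show ?thesis .
qed

lemma uniform_boundedness:
  fixes F :: "'a::banach dual set"
  assumes pw: "\<And>u. \<exists>c. \<forall>f\<in>F. f u \<le> c"
  obtains N where "\<And>f. f \<in> F \<Longrightarrow> norm f \<le> N"
proof -
  define E where "E n = {u. \<forall>f\<in>F. f u \<le> real n}" for n :: nat
  have closed: "closed (E n)" for n
  proof -
    have "E n = (\<Inter>f\<in>F. {u. blinfun_apply f u \<le> real n})" by (auto simp: E_def)
    then show ?thesis by (auto intro!: closed_INT closed_Collect_le continuous_intros)
  qed
  have un: "\<Union>(range E) = UNIV"
  proof -
    have "\<exists>n. u \<in> E n" for u
    proof -
      obtain c where "\<forall>f\<in>F. f u \<le> c" using pw by blast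
      moreover obtain n :: nat where "c \<le> n" using real_arch_simple by blast
      ultimately show ?thesis by (auto simp: E_def intro: order_trans)
    qed
    then show ?thesis by auto
  qed
  have "\<exists>n. interior (E n) \<noteq> {}"
  proof (rule ccontr)
    assume "\<not> ?thesis"
    then have "Met_TC.mtopology interior_of \<Union>(range E) = {}"
      using closed by (intro Met_TC.metric_Baire_category_alt) auto
    then show False by (simp add: un)
  qed
  then obtain n u0 e where e: "0 < e" "ball u0 e \<subseteq> E n"
    by (metis all_not_in_conv mem_interior)
  \<comment> \<open>The bound at \<open>- u0\<close> moves the centre of the ball to the
    origin.\<close>
  obtain c where c: "\<forall>f\<in>F. f (- u0) \<le> c" using pw by blast
  show ?thesis
  proof (rule that)
    fix f assume f: "f \<in> F"
    have "e / 2 * norm f \<le> real n + c"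
    proof (rule norm_blinfun_le_of_cball)
      fix u :: 'a assume "norm u \<le> e / 2"
      then have "u0 + u \<in> E n" using e by (auto simp: dist_norm)
      then have "f (u0 + u) \<le> real n" using f by (auto simp: E_def)
      then show "f u \<le> real n + c" using c f by (force simp: blinfun.bilinear_simps)
    qed (use e in simp)
    then show "norm f \<le> 2 * (real n + c) / e" using e by (simp add: field_simps)
  qed
qed

section \<open>Monotone operators and conic combinations of graphs\<close>

lemma mem_gra [simp]: "(x, xs) \<in> gra A \<longleftrightarrow> xs \<in> A x"
  by (simp add: gra_def)

lemma monotone_opD:
  assumes "monotone_op A" "xs \<in> A x" "ys \<in> A y"
  shows "0 \<le> (xs - ys) (x - y)"
  using assms by (auto simp: monotone_op_def gra_def)

lemma monotonically_related_iff:
  "monotonically_related (x, xs) G \<longleftrightarrow> (\<forall>y ys. (y, ys) \<in> G \<longrightarrow> 0 \<le> (xs - ys) (x - y))"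
  by (auto simp: monotonically_related_def)

lemma maximally_monotone_memI:
  assumes A: "maximally_monotone A"
    and rel: "\<And>y ys. ys \<in> A y \<Longrightarrow> 0 \<le> (xs - ys) (x - y)"
  shows "xs \<in> A x"
proof (rule ccontr)
  assume n: "xs \<notin> A x"
  define B where "B = A(x := insert xs (A x))"
  have "0 \<le> (us - ws) (u - w)" if u: "us \<in> B u" and w: "ws \<in> B w" for u us w ws
  proof -
    have sym: "(us - ws) (u - w) = (ws - us) (w - u)"
      by (simp add: blinfun.bilinear_simps)
    consider "us \<in> A u" "ws \<in> A w" | "us \<in> A u" "w = x" "ws = xs"
      | "u = x" "us = xs" "ws \<in> A w" | "u = w" "us = ws"
      using u w by (auto simp: B_def split: if_splits)
    then show ?thesis
    proof cases
      case 1
      then show ?thesis using A by (auto simp: maximally_monotone_def intro: monotone_opD)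
    next
      case 2
      then show ?thesis using rel sym by simp
    qed (use rel in auto)
  qed
  then have "monotone_op B" by (auto simp: monotone_op_def gra_def)
  moreover have "gra A \<subset> gra B"
    using n by (auto simp: gra_def B_def)
  ultimately show False using A by (auto simp: maximally_monotone_def)
qed

text \<open>The uniform boundedness principle is applied to the functionals
  \<open>y\<^sup>* / (1 + \<parallel>x\<^sup>*\<parallel> + \<langle>y - x, y\<^sup>*\<rangle>)\<close>, whose denominators are at least 1 by monotonicity.\<close>

lemma monotone_op_locally_bounded:
  fixes B :: "'a::banach set_op"
  assumes B: "monotone_op B" and x: "x \<in> interior (dom_op B)"
  obtains r M where "0 < r" "0 \<le> M" "ball x r \<subseteq> dom_op B"
    "\<And>y ys. y \<in> ball x r \<Longrightarrow> ys \<in> B y \<Longrightarrow> norm ys \<le> M"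
proof -
  obtain e where e: "0 < e" "ball x e \<subseteq> dom_op B" using x by (auto simp: mem_interior)
  have "x \<in> dom_op B" using e by auto
  then obtain xs where xs: "xs \<in> B x" by (auto simp: dom_op_def)
  define D where "D y ys = 1 + norm xs + ys (y - x)" for y and ys :: "'a dual"
  have D1: "1 \<le> D y ys" if "ys \<in> B y" "norm (y - x) \<le> 1" for y ys
  proof -
    have "0 \<le> ys (y - x) - xs (y - x)"
      using monotone_opD[OF B that(1) xs] by (simp add: blinfun.bilinear_simps)
    moreover have "norm xs * norm (y - x) \<le> norm xs" using that(2) by (simp add: mult_left_le)
    ultimately show ?thesis
      unfolding D_def using minus_blinfun_apply_le[of xs "y - x"] by linarith
  qed
  define F where "F = {inverse (D y ys) *\<^sub>R ys | y ys. ys \<in> B y \<and> norm (y - x) \<le> 1}"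
  have "\<exists>c. \<forall>f\<in>F. blinfun_apply f u \<le> c" for u
  proof -
    \<comment> \<open>\<open>s\<close> keeps \<open>x + s *\<^sub>R u\<close> within
      \<open>e / 2\<close> of \<open>x\<close>; testing monotonicity there isolates
      \<open>s * ys u\<close>.\<close>
    define s where "s = e / (2 * (norm u + 1))"
    have pos: "0 < norm u + 1" by (simp add: add_nonneg_pos)
    have s: "0 < s" using e pos by (simp add: s_def)
    have "s * norm u \<le> s * (norm u + 1)" using s by (intro mult_left_mono) auto
    also have "\<dots> = e / 2" using pos by (simp add: s_def divide_simps)
    finally have "x + s *\<^sub>R u \<in> dom_op B" using e s by (auto simp: dist_norm intro!: subsetD[OF e(2)])
    then obtain v where v: "v \<in> B (x + s *\<^sub>R u)" by (auto simp: dom_op_def)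
    define k where "k = norm v * (1 + s * norm u)"
    have "f u \<le> (1 + k) / s" if fF: "f \<in> F" for f
    proof -
      obtain y ys where y: "f = inverse (D y ys) *\<^sub>R ys" "ys \<in> B y" "norm (y - x) \<le> 1"
        using fF by (auto simp: F_def)
      have D: "1 \<le> D y ys" using D1 y by blast
      have "0 \<le> (ys - v) (y - (x + s *\<^sub>R u))" by (rule monotone_opD[OF B y(2) v])
      then have "s * ys u \<le> ys (y - x) - v ((y - x) - s *\<^sub>R u)"
        by (simp add: blinfun.bilinear_simps algebra_simps)
      moreover have "- v ((y - x) - s *\<^sub>R u) \<le> norm v * norm ((y - x) - s *\<^sub>R u)"
        by (rule minus_blinfun_apply_le)
      moreover have "norm v * norm ((y - x) - s *\<^sub>R u) \<le> k"
        unfolding k_def using norm_triangle_ineq4[of "y - x" "s *\<^sub>R u"] y(3) s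
        by (intro mult_left_mono) auto
      ultimately have "s * ys u \<le> ys (y - x) + k" by linarith
      also have "\<dots> \<le> D y ys + k" by (simp add: D_def)
      also have "\<dots> \<le> D y ys + D y ys * k"
      proof -
        have "0 \<le> k" using s by (simp add: k_def)
        then have "1 * k \<le> D y ys * k" using D by (intro mult_right_mono) auto
        then show ?thesis by simp
      qed
      finally have "s * ys u \<le> D y ys * (1 + k)" by (simp add: algebra_simps)
      then have "inverse (D y ys) * ys u \<le> (1 + k) / s" using D s by (simp add: field_simps)
      then show ?thesis by (simp add: y(1) blinfun.bilinear_simps)
    qed
    then show ?thesis by blast
  qed
  then obtain N where N: "\<And>f. f \<in> F \<Longrightarrow> norm f \<le> N" using uniform_boundedness[of F] by blast
  define N' where "N' = max N 1"
  \<comment> \<open>The bound \<open>1 / (2 * N')\<close> lets the term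
    \<open>N' * ys (y - x)\<close> be absorbed as half of \<open>norm ys\<close>.\<close>
  define r where "r = min (min e 1) (1 / (2 * N'))"
  have N': "1 \<le> N'" by (simp add: N'_def)
  show ?thesis
  proof (rule that[of r "2 * N' * (1 + norm xs)"])
    show "0 < r" using e N' by (simp add: r_def)
    show "ball x r \<subseteq> dom_op B" using e(2) by (auto simp: r_def)
  next
    fix y ys assume y: "y \<in> ball x r" "ys \<in> B y"
    then have yr: "norm (y - x) \<le> r" by (simp add: dist_norm norm_minus_commute)
    then have y1: "norm (y - x) \<le> 1" by (simp add: r_def)
    have D: "1 \<le> D y ys" by (rule D1[OF y(2) y1])
    have "inverse (D y ys) *\<^sub>R ys \<in> F" using y(2) y1 by (auto simp: F_def)
    then have "norm (inverse (D y ys) *\<^sub>R ys) \<le> N'"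
      unfolding N'_def using N by (meson max.coboundedI1)
    then have "norm ys \<le> N' * D y ys" using D by (simp add: field_simps)
    then have "norm ys \<le> N' * (1 + norm xs) + N' * ys (y - x)" by (simp add: D_def algebra_simps)
    moreover have "N' * ys (y - x) \<le> N' * (norm ys * (1 / (2 * N')))"
    proof (rule mult_left_mono)
      have "ys (y - x) \<le> norm ys * norm (y - x)" by (rule blinfun_apply_le)
      also have "\<dots> \<le> norm ys * (1 / (2 * N'))"
        using yr by (intro mult_left_mono) (auto simp: r_def)
      finally show "ys (y - x) \<le> norm ys * (1 / (2 * N'))" .
    qed (use N' in simp)
    moreover have "N' * (norm ys * (1 / (2 * N'))) = norm ys / 2" using N' by simp
    ultimately show "norm ys \<le> 2 * N' * (1 + norm xs)" by simp
  qed (use N' in simp)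
qed

section \<open>Conic combinations of graph points\<close>

text \<open>The last component is the total weight of a conic combination. With it, being monotonically
  related to the graph becomes an inequality linear in the combination.\<close>

definition graph_cone :: "('a::real_normed_vector \<times> 'a dual) set \<Rightarrow> 'a \<Rightarrow> ('a \<times> 'a dual \<times> real \<times> real) set"
  where "graph_cone G z = convex_cone hull ((\<lambda>(y, ys). (y - z, ys, blinfun_apply ys (y - z), 1)) ` G)"

lemma convex_cone_graph_cone: "convex_cone (graph_cone G z)"
  by (simp add: graph_cone_def convex_cone_convex_cone_hull)

lemma graph_cone_mem: "(y, ys) \<in> G \<Longrightarrow> (y - z, ys, blinfun_apply ys (y - z), 1) \<in> graph_cone G z"
  unfolding graph_cone_def by (rule hull_inc) force

lemma graph_cone_add:
  "(h, hs, g, m) \<in> graph_cone G z \<Longrightarrow> (h', hs', g', m') \<in> graph_cone G z \<Longrightarrow>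
    (h + h', hs + hs', g + g', m + m') \<in> graph_cone G z"
  using convex_cone_add[OF convex_cone_graph_cone, of "(h, hs, g, m)" G z "(h', hs', g', m')"] by simp

lemma graph_cone_scale:
  "(h, hs, g, m) \<in> graph_cone G z \<Longrightarrow> 0 \<le> c \<Longrightarrow>
    (c *\<^sub>R h, c *\<^sub>R hs, c * g, c * m) \<in> graph_cone G z"
  using convex_cone_scaleR[OF convex_cone_graph_cone, of c "(h, hs, g, m)" G z] by simp

lemma graph_cone_induct [consumes 1, case_names generator zero add scale]:
  assumes mem: "(h, hs, g, m) \<in> graph_cone G z"
    and gen: "\<And>y ys. (y, ys) \<in> G \<Longrightarrow> P (y - z) ys (blinfun_apply ys (y - z)) 1"
    and zero: "P 0 0 0 0"
    and add: "\<And>h hs g m h' hs' g' m'. P h hs g m \<Longrightarrow> P h' hs' g' m' \<Longrightarrow>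
      P (h + h') (hs + hs') (g + g') (m + m')"
    and scale: "\<And>c h hs g m. P h hs g m \<Longrightarrow> 0 \<le> c \<Longrightarrow> P (c *\<^sub>R h) (c *\<^sub>R hs) (c * g) (c * m)"
  shows "P h hs g m"
proof -
  let ?S = "{(h, hs, g, m). P h hs g m}"
  have "convex_cone ?S"
    unfolding convex_cone_iff using zero add scale by (auto simp: zero_prod_def)
  then have "graph_cone G z \<subseteq> ?S"
    unfolding graph_cone_def by (intro hull_minimal) (auto intro: gen)
  then show ?thesis using mem by auto
qed

text \<open>Expanding \<open>(xs - ys) (x - y)\<close> about \<open>z\<close> gives an expression
  linear in the four components of a generator, so its nonnegativity survives conic
  combination.\<close>

lemma graph_cone_related:
  assumes "(h, hs, g, m) \<in> graph_cone G z" and "monotonically_related (x, xs) G"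
  shows "0 \<le> g + hs (z - x) - xs h - m * xs (z - x)"
  using assms(1)
proof (induction rule: graph_cone_induct)
  case (generator y ys)
  then have "0 \<le> (xs - ys) (x - y)" using assms(2) by (auto simp: monotonically_related_iff)
  then show ?case by (simp add: blinfun.bilinear_simps)
next
  case (scale c h hs g m)
  have "0 \<le> c * (g + hs (z - x) - xs h - m * xs (z - x))" using scale by simp
  then show ?case by (simp add: blinfun.bilinear_simps algebra_simps)
qed (auto simp: blinfun.bilinear_simps algebra_simps)

text \<open>Dividing by the total weight turns a combination into an average of base points, which
  stays in \<open>C\<close>; weight zero is treated apart.\<close>

lemma graph_cone_base:
  assumes "(h, hs, g, m) \<in> graph_cone G z" and C: "convex C" "C \<noteq> {}"
    and GC: "\<And>y ys. (y, ys) \<in> G \<Longrightarrow> y \<in> C"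
  shows "0 \<le> m \<and> (\<exists>y\<in>C. h = m *\<^sub>R (y - z))"
  using assms(1)
proof (induction rule: graph_cone_induct)
  case (generator y ys)
  then show ?case using GC by auto
next
  case zero
  then show ?case using C by auto
next
  case (add h hs g m h' hs' g' m')
  then obtain y y' where y: "y \<in> C" "y' \<in> C" "h = m *\<^sub>R (y - z)" "h' = m' *\<^sub>R (y' - z)"
    and m: "0 \<le> m" "0 \<le> m'" by blast
  show ?case
  proof (cases "m + m' = 0")
    case True
    then have "m = 0" "m' = 0" using m by auto
    then show ?thesis using y by auto
  next
    case False
    then have pos: "0 < m + m'" using m by auto
    let ?y = "(m / (m + m')) *\<^sub>R y + (m' / (m + m')) *\<^sub>R y'"
    have "?y \<in> C"
      using y m pos by (intro convexD[OF C(1)]) (auto simp flip: add_divide_distrib)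
    moreover have "(m + m') *\<^sub>R ?y = m *\<^sub>R y + m' *\<^sub>R y'"
      using pos by (simp add: scaleR_add_right)
    then have "h + h' = (m + m') *\<^sub>R (?y - z)"
      by (simp add: y(3,4) algebra_simps)
    ultimately show ?thesis using pos by (auto intro: less_imp_le)
  qed
next
  case (scale c h hs g m)
  then show ?case by auto
qed

lemma graph_cone_weight:
  assumes "(h, hs, g, m) \<in> graph_cone G z"
  shows "0 \<le> m \<and> (m = 0 \<longrightarrow> g = 0)"
  using assms by (induction rule: graph_cone_induct) auto

text \<open>Monotonicity is summed over all pairs of generators: first one argument runs over the
  graph, then over the cone. For \<open>h = 0\<close>, together with
  \<open>graph_cone_weight\<close>, it shows that the bounds \<open>f h \<le> g\<close> are
  consistent.\<close>

lemma graph_cone_self: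
  assumes mono: "\<And>x xs y ys. (x, xs) \<in> G \<Longrightarrow> (y, ys) \<in> G \<Longrightarrow> 0 \<le> blinfun_apply (xs - ys) (x - y)"
    and q: "(h, hs, g, m) \<in> graph_cone G z"
  shows "hs h \<le> m * g"
proof -
  have "0 \<le> m' * g + m * g' - hs' h - hs h'" if "(h', hs', g', m') \<in> graph_cone G z" for h' hs' g' m'
    using that
  proof (induction rule: graph_cone_induct)
    case (generator x xs)
    have "monotonically_related (x, xs) G"
      using mono generator by (auto simp: monotonically_related_iff)
    from graph_cone_related[OF q this] show ?case
      by (simp add: blinfun.bilinear_simps algebra_simps)
  next
    case (scale c h' hs' g' m')
    have "0 \<le> c * (m' * g + m * g' - hs' h - hs h')" using scale by simp
    then show ?case by (simp add: blinfun.bilinear_simps algebra_simps)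
  qed (auto simp: blinfun.bilinear_simps algebra_simps)
  from this[OF q] show ?thesis by (simp add: mult.commute)
qed

text \<open>A converse to \<open>graph_cone_base\<close> at weight one: it provides bounds in
  directions that only the convex hull of the domain reaches.\<close>

lemma graph_cone_convex_hull:
  assumes "y \<in> convex hull {y. \<exists>ys. (y, ys) \<in> G}"
  shows "\<exists>hs g. (y - z, hs, g, 1) \<in> graph_cone G z"
proof -
  let ?S = "{y. \<exists>hs g. (y - z, hs, g, 1) \<in> graph_cone G z}"
  have "convex ?S"
  proof (rule convexI)
    fix x y :: 'a and u v :: real
    assume uv: "0 \<le> u" "0 \<le> v" "u + v = 1" and "x \<in> ?S" "y \<in> ?S"
    then obtain hs g hs' g' where
      "(x - z, hs, g, 1) \<in> graph_cone G z" "(y - z, hs', g', 1) \<in> graph_cone G z" by blast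
    then have "(u *\<^sub>R (x - z) + v *\<^sub>R (y - z), u *\<^sub>R hs + v *\<^sub>R hs', u * g + v * g', u * 1 + v * 1)
        \<in> graph_cone G z"
      using uv by (intro graph_cone_add graph_cone_scale)
    moreover have "u *\<^sub>R (x - z) + v *\<^sub>R (y - z) = u *\<^sub>R x + v *\<^sub>R y - z"
      using uv(3) by (simp add: algebra_simps flip: scaleR_add_left)
    ultimately show "u *\<^sub>R x + v *\<^sub>R y \<in> ?S" using uv by auto
  qed
  then have "convex hull {y. \<exists>ys. (y, ys) \<in> G} \<subseteq> ?S"
    by (intro hull_minimal) (auto intro: graph_cone_mem)
  then show ?thesis using assms by auto
qed

lemma convex_cone_graph_cone_bounds: "convex_cone {(h, g). \<exists>hs m. (h, hs, g, m) \<in> graph_cone G z}"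
proof -
  let ?p = "\<lambda>(h::'a, hs::'a dual, g::real, m::real). (h, g)"
  have "linear ?p" by (auto intro!: linearI)
  then have "convex_cone (?p ` graph_cone G z)"
    by (intro convex_cone_linear_image conjI convex_cone_graph_cone)
  moreover have "?p ` graph_cone G z = {(h, g). \<exists>hs m. (h, hs, g, m) \<in> graph_cone G z}"
    by force
  ultimately show ?thesis by simp
qed

section \<open>Domains of maximally monotone operators\<close>

text \<open>Hahn-Banach takes the place of weak-star compactness of the bounded sequence
  \<open>b\<close>: the functional sought obeys the bounds of the graph of \<open>B\<close> at
  \<open>x\<close> and \<open>f u \<le> M * norm u\<close>. These are consistent because each
  \<open>b n\<close> obeys them up to an error that vanishes with
  \<open>norm (x - a n)\<close>.\<close>

lemma maximally_monotone_bounded_limit: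
  assumes B: "maximally_monotone B" and lim: "a \<longlonglongrightarrow> x"
    and b: "\<And>n::nat. b n \<in> B (a n)" and bound: "\<And>n. norm (b n) \<le> M"
  shows "x \<in> dom_op B"
proof -
  define G where "G = gra B"
  have mono: "monotone_op B" using B by (simp add: maximally_monotone_def)
  have "0 \<le> M" using bound[of 0] norm_ge_zero order_trans by blast
  define K where "K = {(h + u, c) | h u c. \<exists>hs g m. (h, hs, g, m) \<in> graph_cone G x \<and> g + M * norm u \<le> c}"
  have KI: "(h + u, c) \<in> K" if "(h, hs, g, m) \<in> graph_cone G x" "g + M * norm u \<le> c" for h hs g m u c
    using that unfolding K_def by blast
  have zero: "(0, 0, 0, 0) \<in> graph_cone G x"
    using convex_cone_contains_0[OF convex_cone_graph_cone, of G x] by (simp add: zero_prod_def)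
  have K: "convex_cone K"
    unfolding convex_cone_iff
  proof (intro conjI ballI allI impI)
    show "0 \<in> K" using KI[OF zero, of 0 0] by (simp add: zero_prod_def)
  next
    fix v w assume "v \<in> K" "w \<in> K"
    then obtain h u c hs g m h' u' c' hs' g' m' where
      v: "v = (h + u, c)" "(h, hs, g, m) \<in> graph_cone G x" "g + M * norm u \<le> c" and
      w: "w = (h' + u', c')" "(h', hs', g', m') \<in> graph_cone G x" "g' + M * norm u' \<le> c'"
      by (force simp: K_def)
    have "M * norm (u + u') \<le> M * norm u + M * norm u'"
      using mult_left_mono[OF norm_triangle_ineq \<open>0 \<le> M\<close>] by (simp add: distrib_left)
    then have "((h + h') + (u + u'), c + c') \<in> K"
      using v(3) w(3) by (intro KI[OF graph_cone_add[OF v(2) w(2)]]) simp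
    then show "v + w \<in> K" by (simp add: v w algebra_simps)
  next
    fix v and r :: real assume "v \<in> K" and r: "0 \<le> r"
    then obtain h u c hs g m where
      v: "v = (h + u, c)" "(h, hs, g, m) \<in> graph_cone G x" "g + M * norm u \<le> c"
      by (force simp: K_def)
    have "r * (g + M * norm u) \<le> r * c" using v(3) r by (rule mult_left_mono)
    then have "r * g + M * norm (r *\<^sub>R u) \<le> r * c" using r by (simp add: algebra_simps)
    from KI[OF graph_cone_scale[OF v(2) r] this]
    show "r *\<^sub>R v \<in> K" by (simp add: v scaleR_add_right)
  qed
  obtain f where f: "\<And>h c. (h, c) \<in> K \<Longrightarrow> blinfun_apply f h \<le> c"
  proof (rule Hahn_Banach_cone[OF K, of 1 M])
    fix c assume "(0, c) \<in> K"
    then obtain h u hs g m where q: "h + u = 0" "(h, hs, g, m) \<in> graph_cone G x" "g + M * norm u \<le> c"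
      by (force simp: K_def)
    have h: "h = - u" using q(1) by (simp add: eq_neg_iff_add_eq_0)
    have m: "0 \<le> m" using graph_cone_weight[OF q(2)] by simp
    have "0 \<le> c + (norm hs + m * M) * norm (x - a n)" for n
    proof -
      have "monotonically_related (a n, b n) G"
        using monotone_opD[OF mono b] by (auto simp: monotonically_related_iff G_def)
      from graph_cone_related[OF q(2) this]
      have "0 \<le> g + hs (x - a n) + b n u + m * (- b n (x - a n))"
        by (simp add: h blinfun.bilinear_simps algebra_simps)
      moreover have "hs (x - a n) \<le> norm hs * norm (x - a n)" by (rule blinfun_apply_le)
      moreover have "b n u \<le> M * norm u"
        using blinfun_apply_le[of "b n" u] mult_right_mono[OF bound[of n] norm_ge_zero[of u]] by linarith
      moreover have "m * (- b n (x - a n)) \<le> m * (M * norm (x - a n))"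
        using minus_blinfun_apply_le[of "b n" "x - a n"]
          mult_right_mono[OF bound[of n] norm_ge_zero[of "x - a n"]] m
        by (intro mult_left_mono) auto
      ultimately show ?thesis using q(3) by (simp add: algebra_simps)
    qed
    moreover have "(\<lambda>n. c + (norm hs + m * M) * norm (x - a n)) \<longlonglongrightarrow> c + (norm hs + m * M) * norm (x - x)"
      by (intro tendsto_intros lim)
    ultimately show "0 \<le> c" using LIMSEQ_le_const by fastforce
  next
    fix u :: 'a assume "norm u < 1"
    then have "M * norm u \<le> M" using \<open>0 \<le> M\<close> by (simp add: mult_left_le)
    then show "\<exists>c\<le>M. (u, c) \<in> K" using KI[OF zero, of u M] by auto
  qed auto
  have "f \<in> B x"
  proof (rule maximally_monotone_memI[OF B])
    fix y ys assume "ys \<in> B y"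
    then have "(y - x, ys, ys (y - x), 1) \<in> graph_cone G x"
      by (intro graph_cone_mem) (simp add: G_def)
    from f[OF KI[OF this, of 0 "ys (y - x)"]] show "0 \<le> (f - ys) (x - y)"
      by (simp add: blinfun.bilinear_simps)
  qed
  then show ?thesis by (auto simp: dom_op_def)
qed

text \<open>By maximality a functional with \<open>f (y - x) \<le> ys (y - x)\<close> on the graph
  lies in \<open>B x\<close>. Consistency is \<open>graph_cone_self\<close>. Local boundedness at
  \<open>x0\<close> gives bounds on a ball about \<open>x0 - x\<close>; a bound in the opposite
  direction, available since \<open>x\<close> is interior to the hull, recentres it at the
  origin.\<close>

lemma interior_convex_hull_dom_subset:
  fixes B :: "'a::banach set_op"
  assumes B: "maximally_monotone B" and x0: "x0 \<in> interior (dom_op B)"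
    and x: "x \<in> interior (convex hull (dom_op B))"
  shows "x \<in> dom_op B"
proof -
  define G where "G = gra B"
  have dom_eq: "dom_op B = {y. \<exists>ys. (y, ys) \<in> G}" by (auto simp: dom_op_def G_def)
  have mono: "monotone_op B" using B by (simp add: maximally_monotone_def)
  obtain r M where r: "0 < r" "0 \<le> M" "ball x0 r \<subseteq> dom_op B"
    and M: "\<And>y ys. y \<in> ball x0 r \<Longrightarrow> ys \<in> B y \<Longrightarrow> norm ys \<le> M"
    using monotone_op_locally_bounded[OF mono x0] by blast
  define K where "K = {(h, g). \<exists>hs m. (h, hs, g, m) \<in> graph_cone G x}"
  have K: "convex_cone K" unfolding K_def by (rule convex_cone_graph_cone_bounds)
  obtain e where e: "0 < e" "ball x e \<subseteq> convex hull (dom_op B)" using x by (auto simp: mem_interior)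
  define s where "s = e / (2 * (norm (x0 - x) + 1))"
  have s: "0 < s" using e by (simp add: s_def add_nonneg_pos)
  have "s * norm (x0 - x) \<le> s * (norm (x0 - x) + 1)" using s by (intro mult_left_mono) auto
  also have "\<dots> = e / 2" using add_nonneg_pos[OF norm_ge_zero[of "x0 - x"] zero_less_one]
    by (simp add: s_def divide_simps)
  finally have "x - s *\<^sub>R (x0 - x) \<in> convex hull (dom_op B)"
    using e s by (intro subsetD[OF e(2)]) (auto simp: dist_norm)
  then have "\<exists>hs g. (x - s *\<^sub>R (x0 - x) - x, hs, g, 1) \<in> graph_cone G x"
    unfolding dom_eq by (rule graph_cone_convex_hull)
  then obtain g where g: "(- s *\<^sub>R (x0 - x), g) \<in> K" by (auto simp: K_def)
  define N where "N = M * (norm (x0 - x) + r) + g / s"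
  obtain f where f: "\<And>h c. (h, c) \<in> K \<Longrightarrow> blinfun_apply f h \<le> c"
  proof (rule Hahn_Banach_cone[OF K _ r(1)])
    fix c assume "(0, c) \<in> K"
    then obtain hs m where q: "(0, hs, c, m) \<in> graph_cone G x" by (auto simp: K_def)
    have "blinfun_apply hs 0 \<le> m * c"
      by (rule graph_cone_self[OF _ q]) (use mono in \<open>auto simp: G_def intro: monotone_opD\<close>)
    then show "0 \<le> c"
      using graph_cone_weight[OF q] by (cases "m = 0") (auto simp: zero_le_mult_iff)
  next
    fix u :: 'a assume u: "norm u < r"
    then have "x0 + u \<in> ball x0 r" by (auto simp: dist_norm)
    then obtain b where b: "b \<in> B (x0 + u)" "norm b \<le> M" using r(3) M by (force simp: dom_op_def)
    have "(x0 + u - x, b (x0 + u - x)) \<in> K"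
      using graph_cone_mem[of "x0 + u" b G x] b(1) by (auto simp: K_def G_def)
    moreover have "(- (x0 - x), g / s) \<in> K"
      using convex_cone_scaleR[OF K _ g, of "1 / s"] s by simp
    ultimately have "(x0 + u - x, b (x0 + u - x)) + (- (x0 - x), g / s) \<in> K"
      by (rule convex_cone_add[OF K])
    then have "(u, b (x0 + u - x) + g / s) \<in> K" by (simp add: algebra_simps)
    moreover have "b (x0 + u - x) + g / s \<le> N"
    proof -
      have "b (x0 + u - x) \<le> norm b * norm (x0 + u - x)" by (rule blinfun_apply_le)
      also have "\<dots> \<le> M * (norm (x0 - x) + r)"
        using b(2) r norm_triangle_ineq[of "x0 - x" u] u
        by (intro mult_mono) (auto simp: algebra_simps)
      finally show ?thesis by (simp add: N_def)
    qed
    ultimately show "\<exists>c\<le>N. (u, c) \<in> K" by blast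
  qed auto
  have "f \<in> B x"
  proof (rule maximally_monotone_memI[OF B])
    fix y ys assume "ys \<in> B y"
    then have "(y - x, ys (y - x)) \<in> K"
      using graph_cone_mem[of y ys G x] by (auto simp: G_def K_def)
    from f[OF this] show "0 \<le> (f - ys) (x - y)"
      by (simp add: blinfun.bilinear_simps)
  qed
  then show ?thesis by (auto simp: dom_op_def)
qed

text \<open>By the previous lemma the interior of the domain is that of its convex hull, hence
  convex. The segment from a domain point \<open>y\<close> to \<open>x0\<close>, without
  \<open>y\<close>, runs inside this interior.\<close>

lemma maximally_monotone_interior_dom:
  fixes B :: "'a::banach set_op"
  assumes B: "maximally_monotone B" and ne: "interior (dom_op B) \<noteq> {}"
  shows "convex (interior (dom_op B))" and "dom_op B \<subseteq> closure (interior (dom_op B))"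
proof -
  let ?H = "convex hull (dom_op B)"
  obtain x0 where x0: "x0 \<in> interior (dom_op B)" using ne by blast
  have "interior ?H \<subseteq> dom_op B"
    using interior_convex_hull_dom_subset[OF B x0] by blast
  then have "interior ?H \<subseteq> interior (dom_op B)" by (simp add: interior_maximal)
  moreover have "interior (dom_op B) \<subseteq> interior ?H" by (intro interior_mono hull_subset)
  ultimately have eq: "interior (dom_op B) = interior ?H" by blast
  show "convex (interior (dom_op B))" unfolding eq by (intro convex_interior convex_convex_hull)
  show "dom_op B \<subseteq> closure (interior (dom_op B))"
  proof
    fix y assume y: "y \<in> dom_op B"
    obtain e where e: "0 < e" "ball x0 e \<subseteq> ?H" using x0 unfolding eq by (auto simp: mem_interior)
    have int: "(1 - t) *\<^sub>R y + t *\<^sub>R x0 \<in> interior ?H" if t: "0 < t" "t \<le> 1" for t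
      unfolding mem_interior
    proof (intro exI conjI subsetI)
      show "0 < t * e" using t e by simp
    next
      fix v assume v: "v \<in> ball ((1 - t) *\<^sub>R y + t *\<^sub>R x0) (t * e)"
      define u where "u = (1 / t) *\<^sub>R (v - ((1 - t) *\<^sub>R y + t *\<^sub>R x0))"
      have "norm u = norm (v - ((1 - t) *\<^sub>R y + t *\<^sub>R x0)) / t" using t by (simp add: u_def)
      moreover have "norm (v - ((1 - t) *\<^sub>R y + t *\<^sub>R x0)) < t * e"
        using v by (simp only: mem_ball dist_norm norm_minus_commute)
      ultimately have "norm u < e" using t by (simp add: pos_divide_less_eq mult.commute)
      then have "x0 + u \<in> ?H" using e by (auto simp: dist_norm)
      moreover have "y \<in> ?H" using y by (rule hull_inc)
      ultimately have "(1 - t) *\<^sub>R y + t *\<^sub>R (x0 + u) \<in> ?H"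
        using t by (intro convexD[OF convex_convex_hull]) auto
      then show "v \<in> ?H" using t by (simp add: u_def scaleR_add_right)
    qed
    have "(\<lambda>n. (1 - 1 / real (Suc n)) *\<^sub>R y + (1 / real (Suc n)) *\<^sub>R x0) \<longlonglongrightarrow> (1 - 0) *\<^sub>R y + 0 *\<^sub>R x0"
      by (intro tendsto_intros LIMSEQ_Suc lim_1_over_n)
    moreover have "(1 - 1 / real (Suc n)) *\<^sub>R y + (1 / real (Suc n)) *\<^sub>R x0 \<in> interior ?H" for n
      by (rule int) auto
    ultimately show "y \<in> closure (interior (dom_op B))"
      unfolding eq closure_sequential by (auto intro!: exI)
  qed
qed

text \<open>The contrapositive of type (FPV): if \<open>(w, ws)\<close> is not in the graph, some
  graph point over \<open>V\<close> fails to be related to it; otherwise \<open>w\<close> itself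
  serves. The functional \<open>ws\<close> can be chosen freely.\<close>

lemma type_FPV_approx:
  assumes A: "type_FPV A" and V: "open V" "convex V" "V \<inter> dom_op A \<noteq> {}" and w: "w \<in> V"
  obtains a as where "a \<in> V" "as \<in> A a" "0 \<le> (as - ws) (w - a)"
proof (cases "ws \<in> A w")
  case True
  then show ?thesis using that[of w ws] w by simp
next
  case False
  then have "\<not> monotonically_related (w, ws) (gra A \<inter> (V \<times> UNIV))"
    using A V w unfolding type_FPV_def by auto
  then obtain a as where a: "as \<in> A a" "a \<in> V" "\<not> 0 \<le> (ws - as) (w - a)"
    by (auto simp: monotonically_related_iff)
  then show ?thesis using that[of a as] by (simp add: blinfun.bilinear_simps)
qed

text \<open>The points considered form the drop from a ball about \<open>x0\<close> to
  \<open>z\<close>. Going from \<open>p\<close> slightly away from \<open>z\<close> leads to a point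
  \<open>q\<close> where \<open>B\<close> is still bounded; testing monotonicity on a ball about
  \<open>q\<close> bounds \<open>r * norm b\<close> by \<open>b (a - q)\<close> plus a constant, and
  \<open>a - q\<close> and \<open>z - a\<close> are both positive multiples of
  \<open>z - p\<close>.\<close>

lemma monotone_op_coercive_on_drop:
  assumes B: "monotone_op B" and r: "0 < r" and dom: "ball x0 (3 * r) \<subseteq> dom_op B"
    and M: "\<And>y ys. y \<in> ball x0 (3 * r) \<Longrightarrow> ys \<in> B y \<Longrightarrow> norm ys \<le> M"
  shows "\<exists>c>0. \<exists>C\<ge>0. \<forall>s p b. 0 \<le> s \<and> s < 1 \<and> p \<in> ball x0 r \<and> b \<in> B ((1 - s) *\<^sub>R p + s *\<^sub>R z) \<longrightarrow>
    c * (1 - s) * norm b - C \<le> b (z - ((1 - s) *\<^sub>R p + s *\<^sub>R z))"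
proof -
  define R where "R = norm (z - x0) + r"
  \<comment> \<open>\<open>R\<close> bounds \<open>norm (z - p)\<close>, and
    \<open>k * R < r\<close> keeps \<open>q + v\<close> in the ball of radius
    \<open>3 * r\<close>.\<close>
  define k where "k = r / (R + 1)"
  define E where "E = M * ((1 + k) * R + r)"
  have R: "0 < R" using r by (simp add: R_def add_nonneg_pos)
  have k: "0 < k" using r R by (simp add: k_def)
  have kR: "k * R < r" using r R by (simp add: k_def field_simps)
  have M0: "0 \<le> M"
  proof -
    have "x0 \<in> ball x0 (3 * r)" using r by simp
    then have "x0 \<in> dom_op B" using dom by blast
    then obtain v where "v \<in> B x0" by (auto simp: dom_op_def)
    then have "norm v \<le> M" using M[of x0] r by simp
    then show ?thesis using norm_ge_zero order_trans by blast
  qed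
  have main: "r / (1 + k) * (1 - s) * norm b - E / k \<le> b (z - ((1 - s) *\<^sub>R p + s *\<^sub>R z))"
    if s: "0 \<le> s" "s < 1" and p: "p \<in> ball x0 r" and b: "b \<in> B ((1 - s) *\<^sub>R p + s *\<^sub>R z)" for s p b
  proof -
    define a where "a = (1 - s) *\<^sub>R p + s *\<^sub>R z"
    define q where "q = p - k *\<^sub>R (z - p)"
    have px: "norm (p - x0) < r" using p by (simp add: dist_norm norm_minus_commute)
    have zp: "norm (z - p) \<le> R"
      using norm_triangle_ineq4[of "z - x0" "p - x0"] px by (simp add: R_def)
    have aq: "a - q = (s + k) *\<^sub>R (z - p)" by (simp add: a_def q_def algebra_simps)
    have za: "z - a = (1 - s) *\<^sub>R (z - p)" by (simp add: a_def algebra_simps)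
    have E: "M * ((s + k) * norm (z - p) + r) \<le> E"
      unfolding E_def using s k zp M0 by (intro mult_left_mono add_mono mult_mono) auto
    have "r * norm b \<le> b (a - q) + E"
    proof (rule norm_blinfun_le_of_cball[OF r])
      fix v :: 'a assume v: "norm v \<le> r"
      have "norm (q + v - x0) \<le> norm (p - x0) + norm (k *\<^sub>R (z - p)) + norm v"
        unfolding q_def using norm_triangle_ineq[of "p - x0 - k *\<^sub>R (z - p)" v]
          norm_triangle_ineq4[of "p - x0" "k *\<^sub>R (z - p)"] by (simp add: algebra_simps)
      also have "norm (k *\<^sub>R (z - p)) \<le> k * R" using k zp by simp
      finally have "norm (q + v - x0) < 3 * r" using px kR v by simp
      then have qv: "q + v \<in> ball x0 (3 * r)" by (simp add: dist_norm norm_minus_commute)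
      then have "q + v \<in> dom_op B" using dom by blast
      then obtain w where w: "w \<in> B (q + v)" by (auto simp: dom_op_def)
      have "0 \<le> (b - w) (a - (q + v))" using monotone_opD[OF B b w] by (simp add: a_def)
      then have "b v \<le> b (a - q) + - w (a - q - v)" by (simp add: blinfun.bilinear_simps)
      moreover have "- w (a - q - v) \<le> norm w * norm (a - q - v)" by (rule minus_blinfun_apply_le)
      moreover have "norm w * norm (a - q - v) \<le> M * ((s + k) * norm (z - p) + r)"
      proof (rule mult_mono)
        show "norm w \<le> M" by (rule M[OF qv w])
        have "norm (a - q) = (s + k) * norm (z - p)" using aq s k by simp
        then show "norm (a - q - v) \<le> (s + k) * norm (z - p) + r"
          using norm_triangle_ineq4[of "a - q" v] v by simp
      qed (use M0 in auto)
      ultimately show "b v \<le> b (a - q) + E" using E by linarith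
    qed
    then have 1: "r * norm b - E \<le> (s + k) * b (z - p)" by (simp add: aq blinfun.bilinear_simps)
    have sk: "0 < s + k" using s k by simp
    \<comment> \<open>\<open>s + k\<close> lies between \<open>k\<close> and \<open>1 + k\<close>:
      the upper value serves for the norm term, the lower one for the constant.\<close>
    have "r / (1 + k) * (1 - s) * norm b - E / k \<le> (1 - s) * (r * norm b / (s + k)) - (1 - s) * (E / (s + k))"
    proof -
      have "r * norm b / (1 + k) \<le> r * norm b / (s + k)"
        using s k r by (intro divide_left_mono) auto
      then have "(1 - s) * (r * norm b / (1 + k)) \<le> (1 - s) * (r * norm b / (s + k))"
        using s by (intro mult_left_mono) auto
      moreover have "(1 - s) * (E / (s + k)) \<le> E / k"
      proof -
        have "0 \<le> E" using M0 k R r by (simp add: E_def)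
        then have "E / (s + k) \<le> E / k" using s k by (intro divide_left_mono) auto
        moreover have "(1 - s) * (E / (s + k)) \<le> 1 * (E / (s + k))"
          using \<open>0 \<le> E\<close> sk s by (intro mult_right_mono) auto
        ultimately show ?thesis by simp
      qed
      ultimately show ?thesis by (simp add: algebra_simps)
    qed
    also have "\<dots> = (1 - s) * ((r * norm b - E) / (s + k))"
      by (simp add: diff_divide_distrib right_diff_distrib)
    also have "\<dots> \<le> (1 - s) * b (z - p)"
      using 1 sk s by (intro mult_left_mono) (auto simp: pos_divide_le_eq mult.commute)
    also have "\<dots> = b (z - a)" by (simp add: za blinfun.bilinear_simps)
    finally show ?thesis
      by (simp add: a_def)
  qed
  show ?thesis
  proof (rule exI[of _ "r / (1 + k)"], rule conjI)
    show "0 < r / (1 + k)" using r k by simp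
    have "0 \<le> E / k" using r k M0 R by (simp add: E_def)
    then show "\<exists>C\<ge>0. \<forall>s p b. 0 \<le> s \<and> s < 1 \<and> p \<in> ball x0 r \<and> b \<in> B ((1 - s) *\<^sub>R p + s *\<^sub>R z) \<longrightarrow>
        r / (1 + k) * (1 - s) * norm b - C \<le> b (z - ((1 - s) *\<^sub>R p + s *\<^sub>R z))"
      using main by (intro exI[of _ "E / k"]) auto
  qed
qed

section \<open>Localizing a point related to the sum\<close>

text \<open>Segments from base points to drop points thus stay in the drop, with a parameter that
  does not grow. \<open>p'\<close> is the normalized average of \<open>q\<close> and
  \<open>p\<close> left after splitting off the \<open>z\<close> part.\<close>

lemma in_drop_mix:
  fixes Q :: "'a::real_vector set"
  assumes Q: "convex Q" "p \<in> Q" "q \<in> Q" and s: "0 \<le> s" "s < 1" and t: "0 \<le> t" "t \<le> 1"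
  obtains p' where "p' \<in> Q"
    "(1 - t) *\<^sub>R q + t *\<^sub>R ((1 - s) *\<^sub>R p + s *\<^sub>R z) = (1 - t * s) *\<^sub>R p' + (t * s) *\<^sub>R z"
proof -
  have "t * s \<le> 1 * s" using s t by (intro mult_right_mono) auto
  then have pos: "0 < 1 - t * s" using s by simp
  define p' where "p' = ((1 - t) / (1 - t * s)) *\<^sub>R q + (t * (1 - s) / (1 - t * s)) *\<^sub>R p"
  have "p' \<in> Q" unfolding p'_def
  proof (rule convexD[OF Q(1) Q(3) Q(2)])
    have "(1 - t) / (1 - t * s) + t * (1 - s) / (1 - t * s) = (1 - t + t * (1 - s)) / (1 - t * s)"
      by (simp only: add_divide_distrib)
    also have "1 - t + t * (1 - s) = 1 - t * s" by (simp add: right_diff_distrib)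
    finally show "(1 - t) / (1 - t * s) + t * (1 - s) / (1 - t * s) = 1" using pos by simp
  qed (use s t pos in auto)
  moreover have "(1 - t * s) *\<^sub>R p' = (1 - t) *\<^sub>R q + (t * (1 - s)) *\<^sub>R p"
    using pos by (simp add: p'_def scaleR_add_right)
  moreover have "t *\<^sub>R ((1 - s) *\<^sub>R p + s *\<^sub>R z) = (t * (1 - s)) *\<^sub>R p + (t * s) *\<^sub>R z"
    by (simp add: scaleR_add_right)
  ultimately show ?thesis using that[of p'] by (simp add: add.assoc)
qed

text \<open>\<open>related\<close> is the monotone relation of \<open>(z, zs)\<close> to the graph
  of the sum over \<open>U\<close>, written as an upper bound at \<open>z - a\<close>. With
  \<open>x0\<close> in \<open>U\<close>, a whole drop from a ball about \<open>x0\<close> to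
  \<open>z\<close> lies in \<open>U\<close>.\<close>

locale related_to_sum =
  fixes A B :: "'a::banach set_op" and U :: "'a set" and x0 z :: 'a and zs :: "'a dual"
  assumes A: "type_FPV A" and convex_dom_A: "convex (dom_op A)"
    and B: "maximally_monotone B"
    and U: "open U" "convex U"
    and x0: "x0 \<in> dom_op A" "x0 \<in> interior (dom_op B)" "x0 \<in> U"
    and z: "z \<in> U"
    and related: "\<And>a as bs. a \<in> U \<Longrightarrow> as \<in> A a \<Longrightarrow> bs \<in> B a \<Longrightarrow> (as + bs - zs) (z - a) \<le> 0"
begin

abbreviation D :: "'a set" where "D \<equiv> interior (dom_op B)"

lemma mono_A: "monotone_op A"
  using A by (simp add: type_FPV_def maximally_monotone_def)

lemma mono_B: "monotone_op B"
  using B by (simp add: maximally_monotone_def)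

lemma D_nonempty: "D \<noteq> {}"
  using x0(2) by auto

lemmas convex_D = maximally_monotone_interior_dom(1)[OF B D_nonempty]
lemmas dom_B_subset = maximally_monotone_interior_dom(2)[OF B D_nonempty]

section \<open>Drop points of dom A lie in the interior of dom B\<close>

text \<open>At a boundary point of \<open>D\<close>, values of \<open>B\<close> can be moved arbitrarily far along an outward normal,
  which contradicts the relation at \<open>z\<close>.\<close>

lemma drop_point_in_D_of_dom_B:
  assumes p: "p \<in> D" and s: "0 \<le> s" "s < 1" and a: "a = (1 - s) *\<^sub>R p + s *\<^sub>R z"
    and aU: "a \<in> U" and as: "as \<in> A a" and bs: "bs \<in> B a"
  shows "a \<in> D"
proof (rule ccontr)
  assume "a \<notin> D"
  then have "s \<noteq> 0" using p a by auto
  then have s0: "0 < s" using s by simp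
  obtain n :: "'a dual" where n: "\<forall>x\<in>D. blinfun_apply n (x - a) \<le> 0" "blinfun_apply n (p - a) < 0"
    using exists_supporting_functional[OF open_interior convex_D p \<open>a \<notin> D\<close>] by blast
  have n_cl: "n (x - a) \<le> 0" if "x \<in> closure D" for x
  proof -
    have "closed {x. n (x - a) \<le> 0}" by (auto intro!: closed_Collect_le continuous_intros)
    then have "closure D \<subseteq> {x. n (x - a) \<le> 0}" using n(1) by (intro closure_minimal) auto
    then show ?thesis using that by auto
  qed
  \<comment> \<open>Seen from \<open>a\<close>, the functional \<open>n\<close> is nonpositive on
    the domain of \<open>B\<close>, so adding \<open>t *\<^sub>R n\<close> preserves the
    monotonicity inequalities.\<close>
  have mem: "bs + t *\<^sub>R n \<in> B a" if t: "0 \<le> t" for t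
  proof (rule maximally_monotone_memI[OF B])
    fix y ys assume y: "ys \<in> B y"
    then have "y \<in> closure D" using dom_B_subset by (auto simp: dom_op_def)
    then have "t * n (y - a) \<le> 0" using n_cl t by (intro mult_nonneg_nonpos) auto
    moreover have "0 \<le> (bs - ys) (a - y)" by (rule monotone_opD[OF mono_B bs y])
    ultimately show "0 \<le> (bs + t *\<^sub>R n - ys) (a - y)"
      by (simp add: blinfun.bilinear_simps algebra_simps)
  qed
  \<comment> \<open>\<open>z - a\<close> is a positive multiple of \<open>a - p\<close>, so
    \<open>n\<close> is positive on it.\<close>
  have "s *\<^sub>R (z - a) = (1 - s) *\<^sub>R (a - p)" by (simp add: a algebra_simps)
  from arg_cong[OF this, of "blinfun_apply n"] have "s * n (z - a) = (1 - s) * n (a - p)"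
    by (simp only: blinfun.scaleR_right real_scaleR_def)
  moreover have "0 < n (a - p)" using n(2) by (simp add: blinfun.bilinear_simps)
  ultimately have "0 < s * n (z - a)" using s by simp
  then have nz: "0 < n (z - a)" using s0 by (simp add: zero_less_mult_iff)
  define k where "k = (as + bs - zs) (z - a)"
  have k: "k + t * n (z - a) \<le> 0" if "0 \<le> t" for t
    using related[OF aU as mem[OF that]] by (simp add: k_def blinfun.bilinear_simps algebra_simps)
  have "k \<le> 0" using k[of 0] by simp
  with k[of "(1 - k) / n (z - a)"] nz show False by simp
qed

text \<open>Points of the graph of \<open>A\<close> produced by type (FPV) near \<open>(1 - t) a + t x\<^sub>0\<close> are used as
  \<open>t \<rightarrow> 0\<close>: the values of \<open>B\<close> there stay bounded, so \<open>a\<close> cannot be a blow-up point of \<open>B\<close>.\<close>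

lemma drop_point_in_dom_B:
  assumes r: "0 < r" "ball x0 (3 * r) \<subseteq> D" "ball x0 r \<subseteq> U"
    and M: "\<And>y ys. y \<in> ball x0 (3 * r) \<Longrightarrow> ys \<in> B y \<Longrightarrow> norm ys \<le> M"
    and p: "p \<in> ball x0 r" and s: "0 \<le> s" "s < 1" and a: "a = (1 - s) *\<^sub>R p + s *\<^sub>R z"
    and aU: "a \<in> U" and as: "as \<in> A a" and aD: "a \<in> closure D"
  shows "a \<in> dom_op B"
proof -
  obtain xs where xs: "xs \<in> A x0" using x0 by (auto simp: dom_op_def)
  have sub: "ball x0 (3 * r) \<subseteq> dom_op B" using r(2) interior_subset by blast
  have "\<exists>c>0. \<exists>C\<ge>0. \<forall>s p b. 0 \<le> s \<and> s < 1 \<and> p \<in> ball x0 r \<and>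
      b \<in> B ((1 - s) *\<^sub>R p + s *\<^sub>R z) \<longrightarrow>
      c * (1 - s) * norm b - C \<le> blinfun_apply b (z - ((1 - s) *\<^sub>R p + s *\<^sub>R z))"
    by (rule monotone_op_coercive_on_drop[OF mono_B r(1) sub M])
  then obtain c C where c: "0 < c" and C: "0 \<le> C" and coer:
    "\<forall>s p b. 0 \<le> s \<and> s < 1 \<and> p \<in> ball x0 r \<and> b \<in> B ((1 - s) *\<^sub>R p + s *\<^sub>R z) \<longrightarrow>
      c * (1 - s) * norm b - C \<le> blinfun_apply b (z - ((1 - s) *\<^sub>R p + s *\<^sub>R z))"
    by (elim exE conjE)
  define L where "L = r + norm (a - x0)"
  define R where "R = norm (z - x0) + norm (z - a)"
  define k where "k = min 1 (r / (R + 1))"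
  define E where "E = (norm as + norm xs) * L"
  define N where "N = (E / k + norm zs * (norm (z - a) + L) + C) / (c * (1 - s))"
  have L: "0 < L" using r by (simp add: L_def add_pos_nonneg)
  have R: "0 \<le> R" by (simp add: R_def)
  have k: "0 < k" "k \<le> 1" using r R by (auto simp: k_def)
  have kR: "k * R < r"
  proof -
    have "k * R \<le> r / (R + 1) * R" using R by (intro mult_right_mono) (auto simp: k_def)
    also have "\<dots> < r" using r R by (simp add: field_simps)
    finally show ?thesis .
  qed
  have step: "\<exists>y ys. ys \<in> B y \<and> norm (y - a) \<le> t * L \<and> norm ys \<le> N" if t: "0 < t" "t < 1" for t
  proof -
    define q where "q = (1 - t) *\<^sub>R a + t *\<^sub>R x0"
    \<comment> \<open>\<open>k\<close> is small enough that this step from \<open>q\<close> towards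
      \<open>z\<close> stays in the ball of radius \<open>t * r\<close>.\<close>
    define w where "w = q + (k * t) *\<^sub>R (z - q)"
    let ?V = "ball q (t * r)"
    \<comment> \<open>The ball about \<open>q\<close> comes from \<open>ball x0 r\<close> by mixing
      with \<open>a\<close>, so convexity puts it into \<open>D\<close> and
      \<open>U\<close>.\<close>
    have ball_x0: "\<exists>v. v \<in> ball x0 r \<and> y = (1 - t) *\<^sub>R a + t *\<^sub>R v" if y: "y \<in> ?V" for y
    proof -
      let ?v = "x0 + (1 / t) *\<^sub>R (y - q)"
      have "norm (y - q) < t * r" using y by (simp add: dist_norm norm_minus_commute)
      then have "?v \<in> ball x0 r" using t by (simp add: dist_norm pos_divide_less_eq mult.commute)
      moreover have "y = (1 - t) *\<^sub>R a + t *\<^sub>R ?v" using t by (simp add: q_def scaleR_add_right)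
      ultimately show ?thesis by blast
    qed
    have VD: "?V \<subseteq> D"
    proof
      fix y assume "y \<in> ?V"
      then obtain v where v: "v \<in> ball x0 r" "y = (1 - t) *\<^sub>R a + t *\<^sub>R v" using ball_x0 by blast
      have "v \<in> ball x0 (3 * r)" using v(1) r(1) by auto
      then have "v \<in> D" using r(2) by blast
      then show "y \<in> D" unfolding v(2) using t aD
        by (intro open_convex_closure_shrink convex_D) auto
    qed
    have VU: "?V \<subseteq> U"
    proof
      fix y assume "y \<in> ?V"
      then obtain v where v: "v \<in> ball x0 r" "y = (1 - t) *\<^sub>R a + t *\<^sub>R v" using ball_x0 by blast
      then show "y \<in> U" using t aU r(3) by (auto intro!: convexD[OF U(2)])
    qed
    have "a \<in> dom_op A" using as by (auto simp: dom_op_def)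
    then have "q \<in> dom_op A" unfolding q_def using x0 t by (intro convexD[OF convex_dom_A]) auto
    moreover have "q \<in> ?V" using t r by simp
    ultimately have V_dom: "?V \<inter> dom_op A \<noteq> {}" by blast
    have "z - q = (1 - t) *\<^sub>R (z - a) + t *\<^sub>R (z - x0)" by (simp add: q_def algebra_simps)
    then have "norm (z - q) \<le> (1 - t) * norm (z - a) + t * norm (z - x0)"
      using norm_triangle_ineq[of "(1 - t) *\<^sub>R (z - a)" "t *\<^sub>R (z - x0)"] t by simp
    also have "\<dots> \<le> 1 * norm (z - a) + 1 * norm (z - x0)"
      using t by (intro add_mono mult_right_mono) auto
    finally have zq: "norm (z - q) \<le> R" by (simp add: R_def)
    have "norm (w - q) = t * (k * norm (z - q))" using k t by (simp add: w_def)
    also have "\<dots> < t * r"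
    proof -
      have "k * norm (z - q) \<le> k * R" using k zq by (intro mult_left_mono) auto
      then show ?thesis using kR t by simp
    qed
    finally have "w \<in> ?V" by (simp add: dist_norm norm_minus_commute)
    obtain y ys where y: "y \<in> ?V" "ys \<in> A y" "0 \<le> (ys - 0) (w - y)"
      by (rule type_FPV_approx[OF A open_ball convex_ball V_dom \<open>w \<in> ?V\<close>])
    have yq: "norm (y - q) < t * r" using y(1) by (simp add: dist_norm norm_minus_commute)
    have "y \<in> dom_op B" using VD y(1) interior_subset by blast
    then obtain bs where bs: "bs \<in> B y" by (auto simp: dom_op_def)
    have qa: "norm (q - a) = t * norm (a - x0)"
    proof -
      have "q - a = t *\<^sub>R (x0 - a)" by (simp add: q_def algebra_simps)
      then show ?thesis using t by (simp add: norm_minus_commute)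
    qed
    have ya: "norm (y - a) \<le> t * L"
      using norm_triangle_ineq[of "y - q" "q - a"] yq qa by (simp add: L_def algebra_simps)
    have "t * r \<le> 1 * r" using t r by (intro mult_right_mono) auto
    moreover have "norm (q - x0) = (1 - t) * norm (a - x0)"
    proof -
      have "q - x0 = (1 - t) *\<^sub>R (a - x0)" by (simp add: q_def algebra_simps)
      then show ?thesis using t by simp
    qed
    moreover have "(1 - t) * norm (a - x0) \<le> 1 * norm (a - x0)"
      using t by (intro mult_right_mono) auto
    ultimately have yx0: "norm (y - x0) \<le> L"
      using norm_triangle_ineq[of "y - q" "q - x0"] yq by (simp add: L_def)
    text \<open>Writing \<open>kt (z - y) = (w - y) + (1 - kt) (y - q)\<close>, with \<open>q\<close> between \<open>a\<close> and \<open>x\<^sub>0\<close>, keeps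
      the functional \<open>ys\<close> under control although its norm is not.\<close>
    have 1: "- (t * E) \<le> ys (y - q)"
    proof -
      have "ys (y - q) = (1 - t) * ys (y - a) + t * ys (y - x0)"
      proof -
        have "y - q = (1 - t) *\<^sub>R (y - a) + t *\<^sub>R (y - x0)" by (simp add: q_def algebra_simps)
        from arg_cong[OF this, of "blinfun_apply ys"] show ?thesis
          by (simp only: blinfun.add_right blinfun.scaleR_right real_scaleR_def)
      qed
      moreover have "- (norm as * (t * L)) \<le> (1 - t) * ys (y - a)"
      proof -
        have "0 \<le> (ys - as) (y - a)" by (rule monotone_opD[OF mono_A y(2) as])
        then have "as (y - a) \<le> ys (y - a)" by (simp add: blinfun.bilinear_simps)
        moreover have "- as (y - a) \<le> norm as * norm (y - a)" by (rule minus_blinfun_apply_le)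
        moreover have "norm as * norm (y - a) \<le> norm as * (t * L)" using ya by (intro mult_left_mono) auto
        ultimately have *: "- (norm as * (t * L)) \<le> ys (y - a)" by linarith
        have "(1 - t) * (norm as * (t * L)) \<le> 1 * (norm as * (t * L))"
          using t L by (intro mult_right_mono) auto
        moreover have "(1 - t) * (- (norm as * (t * L))) \<le> (1 - t) * ys (y - a)"
          using * t by (intro mult_left_mono) auto
        ultimately show ?thesis unfolding mult_minus_right by linarith
      qed
      moreover have "- (t * (norm xs * L)) \<le> t * ys (y - x0)"
      proof -
        have "0 \<le> (ys - xs) (y - x0)" by (rule monotone_opD[OF mono_A y(2) xs])
        then have "xs (y - x0) \<le> ys (y - x0)" by (simp add: blinfun.bilinear_simps)
        moreover have "- xs (y - x0) \<le> norm xs * norm (y - x0)" by (rule minus_blinfun_apply_le)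
        moreover have "norm xs * norm (y - x0) \<le> norm xs * L" using yx0 by (intro mult_left_mono) auto
        ultimately have "- (norm xs * L) \<le> ys (y - x0)" by linarith
        then have "t * (- (norm xs * L)) \<le> t * ys (y - x0)" using t by (intro mult_left_mono) auto
        then show ?thesis by simp
      qed
      ultimately show ?thesis by (simp add: E_def algebra_simps)
    qed
    have E0: "0 \<le> E" using L by (simp add: E_def)
    have kt: "0 < k * t" "k * t \<le> 1" using k t mult_le_one[of k t] by auto
    have "- (t * E) \<le> (k * t) * ys (z - y)"
    proof -
      have "(k * t) *\<^sub>R (z - y) = (w - y) + (1 - k * t) *\<^sub>R (y - q)" by (simp add: w_def algebra_simps)
      from arg_cong[OF this, of "blinfun_apply ys"]
      have "(k * t) * ys (z - y) = ys (w - y) + (1 - k * t) * ys (y - q)"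
        by (simp only: blinfun.add_right blinfun.scaleR_right real_scaleR_def)
      moreover have "(1 - k * t) * (- (t * E)) \<le> (1 - k * t) * ys (y - q)"
        using 1 kt by (intro mult_left_mono) auto
      moreover have "(1 - k * t) * (t * E) \<le> 1 * (t * E)"
        using kt t E0 by (intro mult_right_mono) auto
      ultimately show ?thesis using y(3) by simp
    qed
    then have "t * (- E) \<le> t * (k * ys (z - y))" by (simp add: algebra_simps)
    then have "- E \<le> k * ys (z - y)" using t by (simp only: mult_le_cancel_left_pos)
    then have "- (E / k) \<le> ys (z - y)" using k by (simp add: field_simps)
    moreover have "(ys + bs - zs) (z - y) \<le> 0" using related VU y bs by blast
    moreover have "zs (z - y) \<le> norm zs * (norm (z - a) + L)"
    proof -
      have "t * L \<le> 1 * L" using t L by (intro mult_right_mono) auto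
      then have "norm (z - y) \<le> norm (z - a) + L"
        using norm_triangle_ineq4[of "z - a" "y - a"] ya by simp
      then have "norm zs * norm (z - y) \<le> norm zs * (norm (z - a) + L)" by (rule mult_left_mono) simp
      then show ?thesis using blinfun_apply_le[of zs "z - y"] by linarith
    qed
    ultimately have bz: "bs (z - y) \<le> E / k + norm zs * (norm (z - a) + L)"
      by (simp add: blinfun.bilinear_simps)
    obtain v where v: "v \<in> ball x0 r" "y = (1 - t) *\<^sub>R a + t *\<^sub>R v" using ball_x0[OF y(1)] by blast
    have t': "0 \<le> 1 - t" "1 - t \<le> 1" using t by auto
    \<comment> \<open>\<open>y\<close> lies in the drop with parameter
      \<open>(1 - t) * s \<le> s\<close>, so the coercivity factor \<open>1 - s\<close> serves for
      every \<open>t\<close>.\<close>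
    obtain p' where p': "p' \<in> ball x0 r"
      "(1 - (1 - t)) *\<^sub>R v + (1 - t) *\<^sub>R ((1 - s) *\<^sub>R p + s *\<^sub>R z)
        = (1 - (1 - t) * s) *\<^sub>R p' + ((1 - t) * s) *\<^sub>R z"
      by (rule in_drop_mix[OF convex_ball p v(1) s t'])
    have y_eq: "y = (1 - (1 - t) * s) *\<^sub>R p' + ((1 - t) * s) *\<^sub>R z"
      unfolding p'(2)[symmetric] by (simp add: v(2) a algebra_simps)
    have st: "0 \<le> (1 - t) * s" "(1 - t) * s \<le> s" using s t by (auto simp: mult_left_le_one_le)
    have "c * (1 - (1 - t) * s) * norm bs - C \<le> bs (z - y)"
      using coer[rule_format, of "(1 - t) * s" p' bs] st s p'(1) bs unfolding y_eq[symmetric] by auto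
    moreover have "c * (1 - s) * norm bs \<le> c * (1 - (1 - t) * s) * norm bs"
      using st c by (intro mult_right_mono mult_left_mono) auto
    ultimately have "c * (1 - s) * norm bs \<le> E / k + norm zs * (norm (z - a) + L) + C" using bz by simp
    then have "norm bs \<le> N" using c s by (simp add: N_def pos_le_divide_eq mult.commute)
    then show ?thesis using bs ya by blast
  qed
  \<comment> \<open>\<open>t = 1 / (n + 2)\<close> is strictly below \<open>1\<close> for
    \<open>n = 0\<close> too.\<close>
  have ex: "\<forall>n::nat. \<exists>y ys. ys \<in> B y \<and> norm (y - a) \<le> 1 / real (Suc (Suc n)) * L \<and> norm ys \<le> N"
    by (intro allI step) auto
  from choice[OF ex] obtain y where
    "\<forall>n. \<exists>ys. ys \<in> B (y n) \<and> norm (y n - a) \<le> 1 / real (Suc (Suc n)) * L \<and> norm ys \<le> N" by blast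
  from choice[OF this] obtain ys where y: "\<And>n. ys n \<in> B (y n)"
    "\<And>n. norm (y n - a) \<le> 1 / real (Suc (Suc n)) * L" "\<And>n. norm (ys n) \<le> N" by blast
  have "(\<lambda>n. 1 / real (Suc (Suc n)) * L) \<longlonglongrightarrow> 0 * L"
    by (intro tendsto_intros LIMSEQ_Suc lim_1_over_n)
  then have "(\<lambda>n. y n - a) \<longlonglongrightarrow> 0"
    using y(2) by (intro Lim_null_comparison[of "\<lambda>n. y n - a"]) auto
  then have "y \<longlonglongrightarrow> a" by (simp add: LIM_zero_iff)
  from maximally_monotone_bounded_limit[where a = y and b = ys, OF B this y(1) y(3)]
  show ?thesis .
qed

text \<open>Otherwise the segment from \<open>x0\<close> to \<open>a\<close> meets the frontier of
  \<open>D\<close> at a point \<open>y\<close> that lies in the drop and in the convex domain of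
  \<open>A\<close>. The two preceding lemmas put \<open>y\<close> into \<open>D\<close>, which is
  open and misses its frontier.\<close>

lemma drop_point_in_D:
  assumes r: "0 < r" "ball x0 (3 * r) \<subseteq> D" "ball x0 r \<subseteq> U"
    and M: "\<And>y ys. y \<in> ball x0 (3 * r) \<Longrightarrow> ys \<in> B y \<Longrightarrow> norm ys \<le> M"
    and p: "p \<in> ball x0 r" and s: "0 \<le> s" "s < 1" and a: "a = (1 - s) *\<^sub>R p + s *\<^sub>R z"
    and a_dom: "a \<in> dom_op A"
  shows "a \<in> D"
proof (rule ccontr)
  assume "a \<notin> D"
  then have "closed_segment x0 a \<inter> frontier D \<noteq> {}"
    using x0(2) by (intro connected_Int_frontier) auto
  then obtain t where t: "0 \<le> t" "t \<le> 1" and fr: "(1 - t) *\<^sub>R x0 + t *\<^sub>R a \<in> frontier D"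
    by (auto simp: closed_segment_def)
  define y where "y = (1 - t) *\<^sub>R x0 + t *\<^sub>R a"
  have y: "y \<in> closure D" "y \<notin> D" using fr by (auto simp: y_def frontier_def)
  have x0r: "x0 \<in> ball x0 r" using r by simp
  obtain p' where p': "p' \<in> ball x0 r" "y = (1 - t * s) *\<^sub>R p' + (t * s) *\<^sub>R z"
    unfolding y_def a by (rule in_drop_mix[OF convex_ball p x0r s t])
  have st: "0 \<le> t * s" "t * s < 1"
    using s t mult_right_mono[of t 1 s] by auto
  have yU: "y \<in> U" unfolding p'(2) using st z p'(1) r(3) by (intro convexD[OF U(2)]) auto
  have "y \<in> dom_op A" unfolding y_def using t x0 a_dom by (intro convexD[OF convex_dom_A]) auto
  then obtain as where as: "as \<in> A y" by (auto simp: dom_op_def)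
  have "y \<in> dom_op B" by (rule drop_point_in_dom_B[OF r M p'(1) st p'(2) yU as y(1)])
  then obtain bs where bs: "bs \<in> B y" by (auto simp: dom_op_def)
  have "p' \<in> ball x0 (3 * r)" using p'(1) r(1) by auto
  then have "p' \<in> D" using r(2) by blast
  from drop_point_in_D_of_dom_B[OF this st p'(2) yU as bs] y(2) show False by blast
qed

text \<open>Type (FPV) is applied in a thin tube about the segment from \<open>x0\<close> to a point
  \<open>w\<close> just before \<open>z\<close>, with a large multiple of a norming functional. The
  resulting \<open>a\<close> is in \<open>D\<close> by \<open>drop_point_in_D\<close>, hence far
  from \<open>w\<close>, so \<open>as (z - a)\<close> exceeds the cap that \<open>related\<close>
  and coercivity impose.\<close>

lemma z_in_closure_domains: "z \<in> closure (dom_op A) \<inter> closure D"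
proof (rule ccontr)
  define S where "S = closure (dom_op A) \<inter> closure D"
  assume "z \<notin> closure (dom_op A) \<inter> closure D"
  then have "z \<in> - S" by (simp add: S_def)
  moreover have "open (- S)" by (auto simp: S_def)
  ultimately obtain e where e: "0 < e" "ball z e \<subseteq> - S" using openE by blast
  have dom_D_S: "dom_op A \<inter> D \<subseteq> S" unfolding S_def using closure_subset by blast
  define d where "d = z - x0"
  have "x0 \<in> S" using dom_D_S x0 by blast
  then have "d \<noteq> 0" using \<open>z \<in> - S\<close> by (auto simp: d_def)
  obtain xs where xs: "xs \<in> A x0" using x0 by (auto simp: dom_op_def)
  \<comment> \<open>The minimum puts \<open>w\<close> strictly between \<open>x0\<close> and
    \<open>z\<close>, at distance at most \<open>e / 4\<close> from \<open>z\<close>.\<close>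
  define t where "t = 1 - min (1 / 2) (e / (4 * norm d))"
  define w where "w = x0 + t *\<^sub>R d"
  have t: "0 < t" "t < 1" using e \<open>d \<noteq> 0\<close> by (auto simp: t_def)
  have "(1 - t) * norm d \<le> e / (4 * norm d) * norm d"
    by (intro mult_right_mono) (auto simp: t_def)
  then have small: "(1 - t) * norm d \<le> e / 4" using \<open>d \<noteq> 0\<close> by simp
  define del where "del = e / 2"
  have del: "0 < del" using e by (simp add: del_def)
  have away: "del \<le> norm (w - a)" if "a \<in> dom_op A \<inter> D" for a
  proof -
    have "a \<notin> ball z e" using that dom_D_S e(2) by blast
    then have "e \<le> norm (z - a)" by (simp add: dist_norm)
    moreover have "z - w = (1 - t) *\<^sub>R d" by (simp add: w_def d_def algebra_simps)
    then have "norm (z - w) \<le> e / 4" using small t by simp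
    moreover have "norm (z - a) \<le> norm (z - w) + norm (w - a)"
      using norm_triangle_ineq[of "z - w" "w - a"] by simp
    ultimately show ?thesis using e by (simp add: del_def)
  qed
  obtain r1 M where r1: "0 < r1" "0 \<le> M" "ball x0 r1 \<subseteq> dom_op B"
    and M1: "\<And>y ys. y \<in> ball x0 r1 \<Longrightarrow> ys \<in> B y \<Longrightarrow> norm ys \<le> M"
    using monotone_op_locally_bounded[OF mono_B x0(2)] by blast
  obtain r2 where r2: "0 < r2" "ball x0 r2 \<subseteq> U" by (rule openE[OF U(1) x0(3)])
  define r where "r = min (r1 / 3) r2"
  have r: "0 < r" "ball x0 r \<subseteq> U" using r1 r2 by (auto simp: r_def)
  have "ball x0 (3 * r) \<subseteq> ball x0 r1" by (rule subset_ball) (simp add: r_def)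
  then have rB: "ball x0 (3 * r) \<subseteq> dom_op B"
    and M: "\<And>y ys. y \<in> ball x0 (3 * r) \<Longrightarrow> ys \<in> B y \<Longrightarrow> norm ys \<le> M"
    using r1(3) M1 by (auto simp: subset_iff)
  then have rD: "ball x0 (3 * r) \<subseteq> D" by (simp add: interior_maximal)
  have "\<exists>c>0. \<exists>C\<ge>0. \<forall>s p b. 0 \<le> s \<and> s < 1 \<and> p \<in> ball x0 r \<and>
      b \<in> B ((1 - s) *\<^sub>R p + s *\<^sub>R z) \<longrightarrow>
      c * (1 - s) * norm b - C \<le> blinfun_apply b (z - ((1 - s) *\<^sub>R p + s *\<^sub>R z))"
    by (rule monotone_op_coercive_on_drop[OF mono_B r(1) rB M])
  then obtain c C where c: "0 < c" and C: "0 \<le> C" and coer: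
    "\<forall>s p b. 0 \<le> s \<and> s < 1 \<and> p \<in> ball x0 r \<and> b \<in> B ((1 - s) *\<^sub>R p + s *\<^sub>R z) \<longrightarrow>
      c * (1 - s) * norm b - C \<le> blinfun_apply b (z - ((1 - s) *\<^sub>R p + s *\<^sub>R z))"
    by (elim exE conjE)
  \<comment> \<open>The first bound keeps the tube inside the drop; the second leaves
    \<open>phi (w - a) \<ge> del / 2\<close> after \<open>eps\<close> is lost twice.\<close>
  define eps where "eps = min ((1 - t) * r) (del / 4)"
  have eps: "0 < eps" "eps \<le> (1 - t) * r" "eps \<le> del / 4" using t r del by (auto simp: eps_def)
  define V where "V = (\<Union>x\<in>closed_segment x0 w. \<Union>y\<in>ball 0 eps. {x + y})"
  have V: "open V" "convex V"
    unfolding V_def by (intro open_sums convex_sums; simp)+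
  have seg_V: "x \<in> V" if "x \<in> closed_segment x0 w" for x
    unfolding V_def using that eps(1) by (intro UN_I[of x] UN_I[of 0]) auto
  have x0V: "x0 \<in> V" and wV: "w \<in> V" by (rule seg_V, simp)+
  then have V_dom: "V \<inter> dom_op A \<noteq> {}" using x0(1) by blast
  obtain phi :: "'a dual" where phi: "phi d = norm d" "norm phi \<le> 1"
    using exists_norming_functional[of d] by blast
  define R where "R = norm d + eps"
  \<comment> \<open>\<open>k\<close> makes \<open>k * (del / 2)\<close> exceed the final upper
    estimate by \<open>1\<close>.\<close>
  define k where "k = (2 / del) * (norm xs * R + C + norm zs * (norm d + R) + 1)"
  obtain a as where a: "a \<in> V" "as \<in> A a" "0 \<le> (as - k *\<^sub>R phi) (w - a)"
    by (rule type_FPV_approx[OF A V V_dom wV])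
  obtain l v where l: "0 \<le> l" "l \<le> 1" and v: "norm v < eps" and a_l: "a = (1 - l) *\<^sub>R x0 + l *\<^sub>R w + v"
    using a(1) by (auto simp: V_def closed_segment_def)
  define s where "s = l * t"
  have "l * t \<le> 1 * t" using l t by (intro mult_right_mono) auto
  then have s: "0 \<le> s" "s \<le> t" using l t by (auto simp: s_def)
  have a_eq: "a = x0 + s *\<^sub>R d + v" by (simp add: a_l w_def s_def algebra_simps)
  \<comment> \<open>The offset \<open>v\<close> is absorbed into the base point, which makes
    \<open>a\<close> a drop point.\<close>
  define p where "p = x0 + (1 / (1 - s)) *\<^sub>R v"
  have s1: "s < 1" using s t by simp
  have ap: "a = (1 - s) *\<^sub>R p + s *\<^sub>R z"
  proof -
    have "(1 - s) *\<^sub>R p = (1 - s) *\<^sub>R x0 + v" using s1 by (simp add: p_def scaleR_add_right)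
    then show ?thesis by (simp add: a_eq d_def algebra_simps)
  qed
  have p: "p \<in> ball x0 r"
  proof -
    have "(1 - t) * r \<le> (1 - s) * r" using s r by (intro mult_right_mono) auto
    then have "norm v < r * (1 - s)" using v eps by (simp add: mult.commute)
    then have "norm v / (1 - s) < r" using s1 by (simp add: pos_divide_less_eq)
    then show ?thesis using s1 by (simp add: p_def dist_norm)
  qed
  have a_dom: "a \<in> dom_op A" using a(2) by (auto simp: dom_op_def)
  have aD: "a \<in> D" by (rule drop_point_in_D[OF r(1) rD r(2) M p s(1) s1 ap a_dom])
  have aU: "a \<in> U" unfolding ap using s s1 z p r(2) by (intro convexD[OF U(2)]) auto
  have "a \<in> dom_op B" using aD interior_subset by blast
  then obtain bs where bs: "bs \<in> B a" by (auto simp: dom_op_def)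
  have wa: "w - a = (t - s) *\<^sub>R d - v" by (simp add: w_def a_eq algebra_simps)
  have "norm (w - a) \<le> (t - s) * norm d + eps"
    unfolding wa using norm_triangle_ineq4[of "(t - s) *\<^sub>R d" v] s v by simp
  then have "del \<le> (t - s) * norm d + eps" using away[of a] a_dom aD by simp
  moreover have "phi (w - a) = (t - s) * norm d - phi v" by (simp add: wa blinfun.bilinear_simps phi)
  moreover have "phi v \<le> eps"
  proof -
    have "norm phi * norm v \<le> 1 * eps" using phi v by (intro mult_mono) auto
    then show ?thesis using blinfun_apply_le[of phi v] by linarith
  qed
  ultimately have phi_wa: "del / 2 \<le> phi (w - a)" using eps by simp
  have R0: "0 \<le> R" using eps by (simp add: R_def)
  have k0: "0 \<le> k" using del C R0 by (simp add: k_def)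
  have 1: "k * (del / 2) \<le> as (w - a)"
  proof -
    have "k * (del / 2) \<le> k * phi (w - a)" using phi_wa k0 by (rule mult_left_mono)
    then show ?thesis using a(3) by (simp add: blinfun.bilinear_simps algebra_simps)
  qed
  have ax0: "norm (a - x0) \<le> R"
  proof -
    have "s * norm d \<le> 1 * norm d" using s1 by (intro mult_right_mono) auto
    then show ?thesis
      using norm_triangle_ineq[of "s *\<^sub>R d" v] s v by (simp add: a_eq R_def)
  qed
  have 2: "- (norm xs * R) \<le> (1 - t) * as (a - x0)"
  proof -
    have "0 \<le> (as - xs) (a - x0)" by (rule monotone_opD[OF mono_A a(2) xs])
    then have "xs (a - x0) \<le> as (a - x0)" by (simp add: blinfun.bilinear_simps)
    moreover have "- xs (a - x0) \<le> norm xs * norm (a - x0)" by (rule minus_blinfun_apply_le)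
    moreover have "norm xs * norm (a - x0) \<le> norm xs * R" using ax0 by (rule mult_left_mono) simp
    ultimately have "- (norm xs * R) \<le> as (a - x0)" by linarith
    then have "(1 - t) * (- (norm xs * R)) \<le> (1 - t) * as (a - x0)"
      using t by (intro mult_left_mono) auto
    moreover have "(1 - t) * (norm xs * R) \<le> 1 * (norm xs * R)"
      using t R0 by (intro mult_right_mono) auto
    ultimately show ?thesis unfolding mult_minus_right by linarith
  qed
  have "t *\<^sub>R (z - a) = (w - a) + (1 - t) *\<^sub>R (a - x0)" by (simp add: w_def d_def algebra_simps)
  from arg_cong[OF this, of "blinfun_apply as"]
  have 3: "t * as (z - a) = as (w - a) + (1 - t) * as (a - x0)"
    by (simp only: blinfun.add_right blinfun.scaleR_right real_scaleR_def)
  have 4: "- C \<le> bs (z - a)"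
  proof -
    have "c * (1 - s) * norm bs - C \<le> bs (z - a)"
      using coer[rule_format, of s p bs] s(1) s1 p bs unfolding ap[symmetric] by blast
    moreover have "0 \<le> c * (1 - s) * norm bs" using c s1 by simp
    ultimately show ?thesis by linarith
  qed
  have 5: "zs (z - a) \<le> norm zs * (norm d + R)"
  proof -
    have "norm (z - a) \<le> norm d + R"
      using norm_triangle_ineq4[of d "a - x0"] ax0 by (simp add: d_def)
    then have "norm zs * norm (z - a) \<le> norm zs * (norm d + R)" by (rule mult_left_mono) simp
    then show ?thesis using blinfun_apply_le[of zs "z - a"] by linarith
  qed
  have "as (z - a) \<le> zs (z - a) - bs (z - a)"
    using related[OF aU a(2) bs] by (simp add: blinfun.bilinear_simps)
  then have le: "as (z - a) \<le> norm zs * (norm d + R) + C" using 4 5 by linarith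
  have "t * as (z - a) \<le> t * (norm zs * (norm d + R) + C)"
    using le t by (intro mult_left_mono) auto
  also have "\<dots> \<le> 1 * (norm zs * (norm d + R) + C)" using t C R0 by (intro mult_right_mono) auto
  finally have "t * as (z - a) \<le> norm zs * (norm d + R) + C" by simp
  moreover have "as (w - a) \<le> t * as (z - a) + norm xs * R" using 2 unfolding 3 by simp
  ultimately have "k * (del / 2) \<le> norm zs * (norm d + R) + C + norm xs * R" using 1 by simp
  moreover have "k * (del / 2) = norm xs * R + C + norm zs * (norm d + R) + 1"
    using del by (simp add: k_def)
  ultimately show False by linarith
qed

end

section \<open>Consistency of the bounds\<close>

context related_to_sum
begin

abbreviation coneA where "coneA \<equiv> graph_cone (gra A \<inter> (U \<times> UNIV)) z"

abbreviation coneB where "coneB \<equiv> graph_cone (gra B) z"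

text \<open>This is the consistency inequality \<open>zs h \<le> g + al\<close> before
  \<open>t\<close> tends to \<open>0\<close>. Type (FPV) with functional \<open>0\<close> on small
  balls about \<open>z + t *\<^sub>R h\<close> gives graph points \<open>(a, as)\<close>. There
  \<open>graph_cone_related\<close> bounds \<open>as (a - z)\<close> and \<open>b (a - z)\<close>,
  collecting terms creates the denominators, and \<open>related\<close> brings in
  \<open>zs\<close>.\<close>

lemma cone_bound_at_time:
  assumes q: "(h, hs, g, m) \<in> coneB" and q': "(h, ks, al, l) \<in> coneA"
    and t: "0 < t" "t * m < 1" "t * l < 1"
    and w: "z + t *\<^sub>R h \<in> D" "z + t *\<^sub>R h \<in> closure (dom_op A)" "z + t *\<^sub>R h \<in> U"
  shows "zs h \<le> (al - t * ks h) / (1 - t * l) + (g - t * hs h) / (1 - t * m)"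
proof -
  define w where "w = z + t *\<^sub>R h"
  obtain r M where r: "0 < r" "0 \<le> M" "ball w r \<subseteq> dom_op B"
    and M: "\<And>y ys. y \<in> ball w r \<Longrightarrow> ys \<in> B y \<Longrightarrow> norm ys \<le> M"
    using monotone_op_locally_bounded[OF mono_B w(1)] unfolding w_def by blast
  obtain r2 where r2: "0 < r2" "ball w r2 \<subseteq> U"
    unfolding w_def by (rule openE[OF U(1) w(3)])
  \<comment> \<open>\<open>F v\<close> collects the estimates obtained at radius \<open>v\<close>;
    at \<open>v = 0\<close> it is \<open>t\<close> times the right-hand side.\<close>
  define F where "F v = (t * (al - t * ks h + norm ks * v)) / (1 - t * l)
      + (t * (g - t * hs h + norm hs * v) + M * v) / (1 - t * m) + norm zs * v" for v
  have le_F: "t * zs h \<le> F v" if v: "0 < v" "v < min r r2" for v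
  proof -
    let ?V = "ball w v"
    have "?V \<inter> dom_op A \<noteq> {}"
      using w(2) v(1) unfolding w_def closure_approachable by (force simp: dist_commute)
    moreover have "w \<in> ?V" using v by simp
    ultimately obtain a as where a: "a \<in> ?V" "as \<in> A a" "0 \<le> (as - 0) (w - a)"
      by (rule type_FPV_approx[OF A open_ball convex_ball])
    have aU: "a \<in> U" and ar: "a \<in> ball w r" using a(1) v r2 by auto
    then have "a \<in> dom_op B" using r(3) by blast
    then obtain b where b: "b \<in> B a" by (auto simp: dom_op_def)
    have wa: "norm (w - a) \<le> v" using a(1) by (simp add: dist_norm)
    have za: "z - a = (w - a) - t *\<^sub>R h" by (simp add: w_def)
    have "monotonically_related (a, as) (gra A \<inter> (U \<times> UNIV))"
      using monotone_opD[OF mono_A a(2)] by (auto simp: monotonically_related_iff)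
    note alA = graph_cone_related[OF q' this]
    have "monotonically_related (a, b) (gra B)"
      using monotone_opD[OF mono_B b] by (auto simp: monotonically_related_iff)
    note alB = graph_cone_related[OF q this]
    have th: "t *\<^sub>R h = (w - a) + (a - z)" by (simp add: w_def)
    have f_th: "t * f h = f (w - a) + f (a - z)" for f :: "'a dual"
      using arg_cong[OF th, of "blinfun_apply f"]
      by (simp only: blinfun.add_right blinfun.scaleR_right real_scaleR_def)
    have f_az: "f (z - a) = - f (a - z)" for f :: "'a dual"
      by (simp add: blinfun.bilinear_simps)
    have f_wa: "f (w - a) \<le> norm f * v" "- f (w - a) \<le> norm f * v" for f :: "'a dual"
      using blinfun_apply_le[of f "w - a"] minus_blinfun_apply_le[of f "w - a"]
        mult_left_mono[OF wa norm_ge_zero[of f]] by linarith+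
    \<comment> \<open>No norm bound on \<open>as\<close> is at hand near \<open>w\<close>, so only
      the sign of \<open>as (w - a)\<close> enters; for \<open>b\<close> there is the bound
      \<open>M\<close>.\<close>
    have QA: "as (a - z) * (1 - t * l) \<le> t * (al - t * ks h + norm ks * v)"
    proof -
      have "as (a - z) \<le> t * as h" using f_th[of as] a(3) by simp
      also have "\<dots> \<le> t * (al + ks (z - a) - l * as (z - a))"
        using alA t by (intro mult_left_mono) auto
      also have "\<dots> = t * (al + ks (z - a)) + t * l * as (a - z)"
        by (simp add: f_az[of as] algebra_simps)
      finally have "as (a - z) * (1 - t * l) \<le> t * (al + ks (z - a))" by (simp add: algebra_simps)
      also have "\<dots> \<le> t * (al - t * ks h + norm ks * v)"
        using f_th[of ks] f_az[of ks] f_wa(1)[of ks] t by (intro mult_left_mono) auto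
      finally show ?thesis .
    qed
    have QB: "b (a - z) * (1 - t * m) \<le> t * (g - t * hs h + norm hs * v) + M * v"
    proof -
      have "norm b * v \<le> M * v" using M[OF ar b] v by (intro mult_right_mono) auto
      then have "b (a - z) \<le> t * b h + M * v" using f_th[of b] f_wa(2)[of b] by linarith
      also have "t * b h \<le> t * (g + hs (z - a) - m * b (z - a))"
        using alB t by (intro mult_left_mono) auto
      also have "t * (g + hs (z - a) - m * b (z - a)) = t * (g + hs (z - a)) + t * m * b (a - z)"
        by (simp add: f_az[of b] algebra_simps)
      finally have "b (a - z) * (1 - t * m) \<le> t * (g + hs (z - a)) + M * v" by (simp add: algebra_simps)
      also have "t * (g + hs (z - a)) \<le> t * (g - t * hs h + norm hs * v)"
        using f_th[of hs] f_az[of hs] f_wa(1)[of hs] t by (intro mult_left_mono) auto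
      finally show ?thesis by simp
    qed
    have "as (a - z) \<le> t * (al - t * ks h + norm ks * v) / (1 - t * l)"
      using QA t by (simp add: pos_le_divide_eq)
    moreover have "b (a - z) \<le> (t * (g - t * hs h + norm hs * v) + M * v) / (1 - t * m)"
      using QB t by (simp add: pos_le_divide_eq)
    moreover have "zs (a - z) \<le> as (a - z) + b (a - z)"
      using related[OF aU a(2) b] by (simp add: blinfun.bilinear_simps)
    moreover have "t * zs h \<le> zs (a - z) + norm zs * v"
      using f_th[of zs] f_wa(1)[of zs] by linarith
    ultimately show ?thesis unfolding F_def by linarith
  qed
  have "(F \<longlongrightarrow> F 0) (at_right 0)"
    unfolding F_def using t by (auto intro!: tendsto_eq_intros)
  moreover have "eventually (\<lambda>v. t * zs h \<le> F v) (at_right 0)"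
    unfolding eventually_at_right_field using le_F r r2 by (intro exI[of _ "min r r2"]) auto
  ultimately have "t * zs h \<le> F 0"
    by (intro tendsto_lowerbound[OF _ _ trivial_limit_at_right_real])
  also have "F 0 = t * ((al - t * ks h) / (1 - t * l) + (g - t * hs h) / (1 - t * m))"
    by (simp add: F_def distrib_left)
  finally show ?thesis using t(1) by (simp only: mult_le_cancel_left_pos)
qed

lemma cone_bound_interior:
  assumes q: "(h, hs, g, m) \<in> coneB" and q': "(h, ks, al, l) \<in> coneA"
    and T: "0 < T" "\<And>t. 0 < t \<Longrightarrow> t < T \<Longrightarrow> z + t *\<^sub>R h \<in> D \<inter> closure (dom_op A)"
  shows "zs h \<le> g + al"
proof -
  define F where "F t = (al - t * ks h) / (1 - t * l) + (g - t * hs h) / (1 - t * m)" for t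
  have ml: "0 \<le> m" "0 \<le> l" using graph_cone_weight q q' by blast+
  obtain e where e: "0 < e" "ball z e \<subseteq> U" by (rule openE[OF U(1) z])
  \<comment> \<open>The entries secure in turn the assumption up to \<open>T\<close>,
    \<open>t * m < 1\<close>, \<open>t * l < 1\<close> and \<open>z + t *\<^sub>R h \<in> U\<close>;
    adding \<open>1\<close> keeps the denominators positive.\<close>
  define d where "d = Min {T, 1 / (m + 1), 1 / (l + 1), e / (norm h + 1)}"
  have h1: "0 < norm h + 1" by (simp add: add_nonneg_pos)
  have d: "0 < d" "d \<le> T" "d \<le> 1 / (m + 1)" "d \<le> 1 / (l + 1)" "d \<le> e / (norm h + 1)"
    using T(1) e ml h1 by (auto simp: d_def)
  have "zs h \<le> F t" if t: "0 < t" "t < d" for t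
    unfolding F_def
  proof (rule cone_bound_at_time[OF q q' t(1)])
    have "t < 1 / (m + 1)" using t(2) d(3) by (rule less_le_trans)
    then have "t * (m + 1) < 1" using ml by (simp add: pos_less_divide_eq)
    then show "t * m < 1" using t by (simp add: algebra_simps)
    have "t < 1 / (l + 1)" using t(2) d(4) by (rule less_le_trans)
    then have "t * (l + 1) < 1" using ml by (simp add: pos_less_divide_eq)
    then show "t * l < 1" using t by (simp add: algebra_simps)
    show "z + t *\<^sub>R h \<in> D" "z + t *\<^sub>R h \<in> closure (dom_op A)" using T(2)[of t] t d(2) by auto
    have "t < e / (norm h + 1)" using t d(5) by linarith
    then have "t * (norm h + 1) < e" using h1 by (simp add: pos_less_divide_eq)
    then have "norm (t *\<^sub>R h) < e" using t by (simp add: algebra_simps)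
    then show "z + t *\<^sub>R h \<in> U" using e(2) by (auto simp: dist_norm)
  qed
  then have "eventually (\<lambda>t. zs h \<le> F t) (at_right 0)"
    unfolding eventually_at_right_field using d(1) by blast
  moreover have "(F \<longlongrightarrow> al + g) (at_right 0)"
    unfolding F_def by (auto intro!: tendsto_eq_intros)
  ultimately show ?thesis
    using tendsto_lowerbound[OF _ _ trivial_limit_at_right_real, of F "al + g" 0 "zs h"] by simp
qed

text \<open>Mixing in a small multiple of \<open>x\<^sub>0 - z\<close> moves the ray from \<open>z\<close> into \<open>D\<close>.\<close>

lemma cone_bound:
  assumes q: "(h, hs, g, m) \<in> coneB" and q': "(h, ks, al, l) \<in> coneA"
  shows "zs h \<le> g + al"
proof -
  have z_cl: "z \<in> closure (dom_op A)" "z \<in> closure D" using z_in_closure_domains by auto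
  obtain xs where xs: "xs \<in> A x0" using x0 by (auto simp: dom_op_def)
  have "x0 \<in> dom_op B" using x0(2) interior_subset by blast
  then obtain bs where bs: "bs \<in> B x0" by (auto simp: dom_op_def)
  have "0 \<le> m \<and> (\<exists>y\<in>closure D. h = m *\<^sub>R (y - z))"
  proof (rule graph_cone_base[OF q])
    show "y \<in> closure D" if "(y, ys) \<in> gra B" for y ys
      using that dom_B_subset by (auto simp: dom_op_def)
  qed (use convex_D z_cl in auto)
  then obtain y where m: "0 \<le> m" and y: "y \<in> closure D" "h = m *\<^sub>R (y - z)" by blast
  have "0 \<le> l \<and> (\<exists>a\<in>dom_op A. h = l *\<^sub>R (a - z))"
    by (rule graph_cone_base[OF q' convex_dom_A]) (use x0 in \<open>auto simp: dom_op_def\<close>)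
  then obtain a where l: "0 \<le> l" and a: "a \<in> dom_op A" "h = l *\<^sub>R (a - z)" by blast
  define c where "c = bs (x0 - z) + xs (x0 - z) - zs (x0 - z)"
  have "zs h \<le> g + al + e * c" if e: "0 < e" for e
  proof -
    define h' where "h' = h + e *\<^sub>R (x0 - z)"
    have 1: "(h', hs + e *\<^sub>R bs, g + e * bs (x0 - z), m + e * 1) \<in> coneB"
      unfolding h'_def using bs e by (intro graph_cone_add[OF q] graph_cone_scale graph_cone_mem) auto
    have 2: "(h', ks + e *\<^sub>R xs, al + e * xs (x0 - z), l + e * 1) \<in> coneA"
      unfolding h'_def using xs e x0 by (intro graph_cone_add[OF q'] graph_cone_scale graph_cone_mem) auto
    \<comment> \<open>For small \<open>t\<close> this point mixes \<open>x0\<close>, with weight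
      \<open>t * e\<close>, and a point of the segment from \<open>z\<close> to \<open>v\<close>,
      whose parameter \<open>s\<close> solves \<open>(1 - t * e) * s = t * k\<close>. It serves for
      the closures of \<open>D\<close> and of the domain of \<open>A\<close>.\<close>
    have mix: "z + t *\<^sub>R h' \<in> {(1 - t * e) *\<^sub>R v + (t * e) *\<^sub>R x0 | v. v \<in> S}"
      if S: "convex S" "z \<in> S" "v \<in> S" "h = k *\<^sub>R (v - z)" "0 \<le> k" and t: "0 < t" "t * (k + e) < 1"
      for S v k t
    proof -
      have te: "0 < 1 - t * e"
      proof -
        have "0 \<le> t * k" using S t by simp
        then show ?thesis using t(2) by (simp add: distrib_left)
      qed
      define s where "s = t * k / (1 - t * e)"
      have s: "0 \<le> s" "s \<le> 1" using te t S by (auto simp: s_def pos_divide_le_eq distrib_left)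
      have "(1 - s) *\<^sub>R z + s *\<^sub>R v \<in> S" using s S by (intro convexD[OF S(1)]) auto
      moreover have "z + t *\<^sub>R h' = (1 - t * e) *\<^sub>R ((1 - s) *\<^sub>R z + s *\<^sub>R v) + (t * e) *\<^sub>R x0"
      proof -
        have "(1 - t * e) *\<^sub>R ((1 - s) *\<^sub>R z + s *\<^sub>R v) = (1 - t * e) *\<^sub>R z + ((1 - t * e) * s) *\<^sub>R (v - z)"
          by (simp add: algebra_simps)
        also have "(1 - t * e) * s = t * k" using te by (simp add: s_def)
        finally show ?thesis by (simp add: h'_def S(4) algebra_simps)
      qed
      ultimately show ?thesis by blast
    qed
    define T where "T = min (1 / (m + e)) (1 / (l + e))"
    have "0 < T" using e m l by (simp add: T_def)
    moreover have "z + t *\<^sub>R h' \<in> D \<inter> closure (dom_op A)" if t: "0 < t" "t < T" for t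
    proof -
      have tm: "t * (m + e) < 1" and tl: "t * (l + e) < 1"
        using t e m l by (auto simp: T_def pos_less_divide_eq)
      have "0 \<le> t * m" using t m by simp
      then have te: "0 < t * e" "t * e \<le> 1" using tm t e by (auto simp: distrib_left)
      obtain u where u: "u \<in> closure D" "z + t *\<^sub>R h' = (1 - t * e) *\<^sub>R u + (t * e) *\<^sub>R x0"
        using mix[OF convex_closure[OF convex_D] z_cl(2) y m t(1) tm] by auto
      have "z + t *\<^sub>R h' \<in> D"
        unfolding u(2) by (rule open_convex_closure_shrink[OF open_interior convex_D x0(2) u(1) te])
      moreover have "z + t *\<^sub>R h' \<in> closure (dom_op A)"
      proof -
        have cl: "a \<in> closure (dom_op A)" "x0 \<in> closure (dom_op A)"
          using a(1) x0(1) closure_subset by blast+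
        obtain v where "v \<in> closure (dom_op A)" "z + t *\<^sub>R h' = (1 - t * e) *\<^sub>R v + (t * e) *\<^sub>R x0"
          using mix[OF convex_closure[OF convex_dom_A] z_cl(1) cl(1) a(2) l t(1) tl] by auto
        then show ?thesis
          using te cl(2) convexD[OF convex_closure[OF convex_dom_A], of v x0 "1 - t * e" "t * e"] by simp
      qed
      ultimately show ?thesis by blast
    qed
    ultimately have "zs h' \<le> (g + e * bs (x0 - z)) + (al + e * xs (x0 - z))"
      by (rule cone_bound_interior[OF 1 2])
    then show ?thesis by (simp add: h'_def c_def blinfun.bilinear_simps algebra_simps)
  qed
  then have "eventually (\<lambda>e. zs h \<le> g + al + e * c) (at_right 0)"
    unfolding eventually_at_right_field by (intro exI[of _ 1]) auto
  moreover have "((\<lambda>e. g + al + e * c) \<longlongrightarrow> g + al) (at_right 0)"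
    by (auto intro!: tendsto_eq_intros)
  ultimately show ?thesis
    by (intro tendsto_lowerbound[OF _ _ trivial_limit_at_right_real])
qed

text \<open>In a splitting of \<open>zs\<close> into \<open>zs - f\<close> and \<open>f\<close>,
  membership in \<open>B z\<close> asks for \<open>f h \<le> g\<close> on \<open>coneB\<close>, and
  membership in \<open>A z\<close> for \<open>f (- h') \<le> al - zs h'\<close> on
  \<open>coneA\<close>. \<open>K\<close> adds the two families, and their consistency is
  \<open>cone_bound\<close>.\<close>

lemma zs_in_sum: "zs \<in> sum_op A B z"
proof -
  define K where "K = {(h - h', g + al - zs h') | h h' g al hs m ks l.
    (h, hs, g, m) \<in> coneB \<and> (h', ks, al, l) \<in> coneA}"
  have KI: "(h - h', g + al - zs h') \<in> K" if "(h, hs, g, m) \<in> coneB" "(h', ks, al, l) \<in> coneA"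
    for h h' g al hs m ks l
    unfolding K_def using that by blast
  have zero: "(0, 0, 0, 0) \<in> graph_cone G z" for G
    using convex_cone_contains_0[OF convex_cone_graph_cone, of G z] by (simp add: zero_prod_def)
  have K: "convex_cone K"
    unfolding convex_cone_iff
  proof (intro conjI ballI allI impI)
    show "0 \<in> K" using KI[OF zero zero] by (simp add: zero_prod_def)
  next
    fix v w assume "v \<in> K" "w \<in> K"
    then obtain h h' g al hs m ks l h1 h1' g1 al1 hs1 m1 ks1 l1 where
      v: "v = (h - h', g + al - zs h')" "(h, hs, g, m) \<in> coneB" "(h', ks, al, l) \<in> coneA" and
      w: "w = (h1 - h1', g1 + al1 - zs h1')" "(h1, hs1, g1, m1) \<in> coneB" "(h1', ks1, al1, l1) \<in> coneA"
      unfolding K_def by blast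
    show "v + w \<in> K"
      using KI[OF graph_cone_add[OF v(2) w(2)] graph_cone_add[OF v(3) w(3)]]
      by (simp add: v(1) w(1) blinfun.bilinear_simps algebra_simps)
  next
    fix v and r :: real assume "v \<in> K" and r: "0 \<le> r"
    then obtain h h' g al hs m ks l where
      v: "v = (h - h', g + al - zs h')" "(h, hs, g, m) \<in> coneB" "(h', ks, al, l) \<in> coneA"
      unfolding K_def by blast
    show "r *\<^sub>R v \<in> K"
      using KI[OF graph_cone_scale[OF v(2) r] graph_cone_scale[OF v(3) r]]
      by (simp add: v(1) blinfun.bilinear_simps algebra_simps)
  qed
  obtain xs where xs: "xs \<in> A x0" using x0 by (auto simp: dom_op_def)
  obtain r M where r: "0 < r" "0 \<le> M" "ball x0 r \<subseteq> dom_op B"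
    and M: "\<And>y ys. y \<in> ball x0 r \<Longrightarrow> ys \<in> B y \<Longrightarrow> norm ys \<le> M"
    using monotone_op_locally_bounded[OF mono_B x0(2)] by blast
  define N where "N = M * (norm (x0 - z) + r) + xs (x0 - z) - zs (x0 - z)"
  obtain f where f: "\<And>h c. (h, c) \<in> K \<Longrightarrow> blinfun_apply f h \<le> c"
  proof (rule Hahn_Banach_cone[OF K _ r(1)])
    fix c assume "(0, c) \<in> K"
    then obtain h h' g al hs m ks l where
      v: "0 = h - h'" "c = g + al - zs h'" "(h, hs, g, m) \<in> coneB" "(h', ks, al, l) \<in> coneA"
      unfolding K_def by blast
    then show "0 \<le> c" using cone_bound[of h hs g m ks al l] by simp
  next
    fix u :: 'a assume u: "norm u < r"
    then have xu: "x0 + u \<in> ball x0 r" by (auto simp: dist_norm)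
    then have "x0 + u \<in> dom_op B" using r(3) by blast
    then obtain b where b: "b \<in> B (x0 + u)" by (auto simp: dom_op_def)
    have "(x0 + u - z, b, blinfun_apply b (x0 + u - z), 1) \<in> coneB"
      using b by (intro graph_cone_mem) simp
    moreover have "(x0 - z, xs, blinfun_apply xs (x0 - z), 1) \<in> coneA"
      using xs x0 by (intro graph_cone_mem) simp
    ultimately have "(u, b (x0 + u - z) + xs (x0 - z) - zs (x0 - z)) \<in> K"
      using KI[of "x0 + u - z" b "b (x0 + u - z)" 1 "x0 - z"] by fastforce
    moreover have "b (x0 + u - z) \<le> M * (norm (x0 - z) + r)"
    proof -
      have "b (x0 + u - z) \<le> norm b * norm (x0 + u - z)" by (rule blinfun_apply_le)
      also have "\<dots> \<le> M * (norm (x0 - z) + r)"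
        using M[OF xu b] r norm_triangle_ineq[of "x0 - z" u] u
        by (intro mult_mono) (auto simp: algebra_simps)
      finally show ?thesis .
    qed
    ultimately show "\<exists>c\<le>N. (u, c) \<in> K" unfolding N_def by (intro exI conjI) auto
  qed auto
  have fB: "f \<in> B z"
  proof (rule maximally_monotone_memI[OF B])
    fix y ys assume "ys \<in> B y"
    then have "(y - z, ys, blinfun_apply ys (y - z), 1) \<in> coneB" by (intro graph_cone_mem) simp
    from f[OF KI[OF this zero]] show "0 \<le> (f - ys) (z - y)"
      by (simp add: blinfun.bilinear_simps)
  qed
  have "monotonically_related (z, zs - f) (gra A \<inter> (U \<times> UNIV))"
    unfolding monotonically_related_iff
  proof (intro allI impI)
    fix y ys assume "(y, ys) \<in> gra A \<inter> (U \<times> UNIV)"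
    then have "(y - z, ys, blinfun_apply ys (y - z), 1) \<in> coneA" by (rule graph_cone_mem)
    from f[OF KI[OF zero this]] show "0 \<le> (zs - f - ys) (z - y)"
      by (simp add: blinfun.bilinear_simps)
  qed
  then have "zs - f \<in> A z"
    using A U z x0 unfolding type_FPV_def by auto
  then show ?thesis using fB by (force simp: sum_op_def)
qed

end

section \<open>Type (FPV) of the sum from the local result\<close>

theorem corollary4p6:
  fixes A B :: "'a::banach set_op"
  assumes "maximally_monotone A"
    and "maximally_monotone B"
    and "dom_op A \<inter> interior (dom_op B) \<noteq> {}"
    and "type_FPV A"
    and "convex (dom_op A)"
  shows "type_FPV (sum_op A B)"
proof -
  have mono_A: "monotone_op A" and mono_B: "monotone_op B"
    using assms(1,2) by (simp_all add: maximally_monotone_def)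
  obtain x1 where x1: "x1 \<in> dom_op A" "x1 \<in> interior (dom_op B)" using assms(3) by blast
  have ne: "interior (dom_op B) \<noteq> {}" using x1 by blast
  note D = maximally_monotone_interior_dom[OF assms(2) ne]
  have mono: "monotone_op (sum_op A B)"
  proof -
    have "0 \<le> (us - vs) (u - v)" if u: "us \<in> sum_op A B u" and v: "vs \<in> sum_op A B v" for u us v vs
    proof -
      obtain as bs where us: "us = as + bs" "as \<in> A u" "bs \<in> B u" using u by (auto simp: sum_op_def)
      obtain cs ds where vs: "vs = cs + ds" "cs \<in> A v" "ds \<in> B v" using v by (auto simp: sum_op_def)
      have "0 \<le> (as - cs) (u - v)" "0 \<le> (bs - ds) (u - v)"
        using us vs by (auto intro: monotone_opD[OF mono_A] monotone_opD[OF mono_B])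
      then show ?thesis by (simp add: us vs blinfun.bilinear_simps)
    qed
    then show ?thesis by (auto simp: monotone_op_def gra_def)
  qed
  have FPV: "zs \<in> sum_op A B z"
    if U: "open U" "convex U" "U \<inter> dom_op (sum_op A B) \<noteq> {}" and z: "z \<in> U"
      and rel: "monotonically_related (z, zs) (gra (sum_op A B) \<inter> (U \<times> UNIV))" for U z zs
  proof -
    obtain y where y: "y \<in> U" "y \<in> dom_op A" "y \<in> dom_op B"
      using U(3) by (auto simp: dom_op_def sum_op_def)
    have ycl: "y \<in> closure (interior (dom_op B))" using y(3) D(2) by blast
    obtain e where e: "0 < e" "ball y e \<subseteq> U" by (rule openE[OF U(1) y(1)])
    \<comment> \<open>A small \<open>t\<close> keeps \<open>x0\<close> near \<open>y\<close>, hence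
      in \<open>U\<close>, while the move towards \<open>x1\<close> brings it into the interior of
      the domain of \<open>B\<close>.\<close>
    define t where "t = min 1 (e / (2 * (norm (x1 - y) + 1)))"
    have pos: "0 < norm (x1 - y) + 1" by (simp add: add_nonneg_pos)
    have t: "0 < t" "t \<le> 1" using e pos by (auto simp: t_def)
    define x0 where "x0 = (1 - t) *\<^sub>R y + t *\<^sub>R x1"
    have "t * norm (x1 - y) \<le> t * (norm (x1 - y) + 1)" using t by (intro mult_left_mono) auto
    also have "\<dots> \<le> e / (2 * (norm (x1 - y) + 1)) * (norm (x1 - y) + 1)"
      using pos by (intro mult_right_mono) (auto simp: t_def)
    also have "\<dots> = e / 2" using pos by (simp add: divide_simps)
    finally have "norm (t *\<^sub>R (x1 - y)) < e" using t e by simp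
    moreover have "x0 = y + t *\<^sub>R (x1 - y)" by (simp add: x0_def algebra_simps)
    ultimately have "x0 \<in> ball y e" by (simp add: dist_norm)
    then have "x0 \<in> U" using e by blast
    moreover have "x0 \<in> dom_op A"
      unfolding x0_def using t y x1 by (intro convexD[OF assms(5)]) auto
    moreover have "x0 \<in> interior (dom_op B)"
      unfolding x0_def by (rule open_convex_closure_shrink[OF open_interior D(1) x1(2) ycl t])
    moreover have "(as + bs - zs) (z - a) \<le> 0" if "a \<in> U" "as \<in> A a" "bs \<in> B a" for a as bs
    proof -
      have "(a, as + bs) \<in> gra (sum_op A B) \<inter> (U \<times> UNIV)" using that by (auto simp: sum_op_def)
      then have "0 \<le> (zs - (as + bs)) (z - a)" using rel by (auto simp: monotonically_related_iff)
      then show ?thesis by (simp add: blinfun.bilinear_simps)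
    qed
    ultimately interpret related_to_sum A B U x0 z zs
      using assms(2,4,5) U(1,2) z by unfold_locales auto
    show ?thesis by (rule zs_in_sum)
  qed
  have x1_sum: "UNIV \<inter> dom_op (sum_op A B) \<noteq> {}"
  proof -
    have "x1 \<in> dom_op B" using x1(2) interior_subset by blast
    then show ?thesis using x1(1) by (auto simp: dom_op_def sum_op_def)
  qed
  \<comment> \<open>Maximality is the case \<open>U = UNIV\<close>: an extra point of a monotone
    extension is related to the whole graph of the sum.\<close>
  have "\<not> gra (sum_op A B) \<subset> gra C" if C: "monotone_op C" for C
  proof
    assume sub: "gra (sum_op A B) \<subset> gra C"
    then obtain z zs where zs: "zs \<in> C z" "zs \<notin> sum_op A B z" by (auto simp: gra_def)
    have "monotonically_related (z, zs) (gra (sum_op A B) \<inter> (UNIV \<times> UNIV))"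
      unfolding monotonically_related_iff
    proof (intro allI impI)
      fix y ys assume "(y, ys) \<in> gra (sum_op A B) \<inter> (UNIV \<times> UNIV)"
      then have "(y, ys) \<in> gra C" using sub by blast
      then have "ys \<in> C y" by simp
      then show "0 \<le> (zs - ys) (z - y)" by (rule monotone_opD[OF C zs(1)])
    qed
    from FPV[OF open_UNIV convex_UNIV x1_sum UNIV_I this] zs(2) show False by blast
  qed
  then have "maximally_monotone (sum_op A B)"
    using mono by (auto simp: maximally_monotone_def)
  then show ?thesis unfolding type_FPV_def using FPV by auto
qed

end
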